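(* Let $F$ be Thompson's group with generators $x_0,x_1$, acting on $L_2([0,1])$ by $(\pi_g f)(x)=\sqrt{\frac{d\,g^{-1}(x)}{dx}}\,f(g^{-1}(x))$, and let $B=\{h^{(0)}\}\cup\{h^{(i)}_j : i\ge0,\ 1\le j\le 2^i\}$ be the Haar wavelet basis. Let $D$ be the set of dyadic rationals in $(0,1)$ and let $\psi:B\setminus\{h^{(0)}\}\to D$ be the bijection $\psi(h^{(i)}_j)=\frac{j-1}{2^i}+\frac1{2^{i+1}}$. The Schreier graph of the action of $F$ on $L_2([0,1])$ with respect to the basis $B$ and the generating set $\{x_0,x_1\}$ has exactly the following arrows. (1) Arrows labelled $x_0$: from each of the vertices $h^{(0)},h^{(0)}_1,h^{(1)}_2$ there are arrows to each of $h^{(0)},h^{(0)}_1,h^{(1)}_1$ and to no other vertex; from every other vertex $h\in B$ there is exactly one arrow, and it goes to $\psi^{-1}\bigl(x_0(\psi(h))\bigr)$. (2) Arrows labelled $x_1$: from each of the vertices $h^{(0)},h^{(0)}_1,h^{(1)}_2,h^{(2)}_4$ there are arrows to each of $h^{(0)},h^{(0)}_1,h^{(1)}_2,h^{(2)}_3$ and to no other vertex; from every other vertex $h\in B$ there is exactly one arrow, and it goes to $\psi^{-1}\bigl(x_1(\psi(h))\bigr)$.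
   Context: Thompson's group $F$ is the group of all strictly increasing piecewise linear homeomorphisms of $[0,1]$ that are differentiable except at finitely many dyadic rational numbers and whose derivatives on the intervals of differentiability are integer powers of $2$. $F$ is generated by $x_0,x_1$, where $x_0(t)=t/2$ on $[0,\frac12]$, $t-\frac14$ on $[\frac12,\frac34]$, $2t-1$ on $[\frac34,1]$; $x_1(t)=t$ on $[0,\frac12]$, $\frac t2+\frac14$ on $[\frac12,\frac34]$, $t-\frac18$ on $[\frac34,\frac78]$, $2t-1$ on $[\frac78,1]$. The Haar basis is the orthonormal basis of $L_2([0,1])$ consisting of $h^{(0)}\equiv1$ and, for $i\ge0$, $1\le j\le 2^i$, the functions $h^{(i)}_j$ equal to $-2^{i/2}$ on $[\frac{j-1}{2^i},\frac{j-1}{2^i}+\frac1{2^{i+1}})$, to $2^{i/2}$ on $[\frac{j-1}{2^i}+\frac1{2^{i+1}},\frac{j}{2^i}]$, and to $0$ elsewhere. (Note that $h^{(0)}$ and $h^{(0)}_1$ are different functions.) Let $\mathcal H$ be a Hilbert space with orthonormal basis $\{h_i\}$, and let a group $G=\langle S\rangle$ act on $\mathcal H$ by bounded operators $\pi_g$. The Schreier graph of the action of $G$ on $\mathcal H$ with respect to $\{h_i\}$ and $S$ is the oriented labelled graph with vertex set $\{h_i\}$ and an arrow labelled $s\in S$ from $h_i$ to $h_j$ if and only if $\langle\pi_s(h_i),h_j\rangle\ne0$. *)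

theory Defs
  imports "HOL-Analysis.Analysis" "HOL-Algebra.Bij" "Graph_Theory.Digraph"
begin

section \<open>The Hilbert space of square-integrable functions on the unit interval\<close>

abbreviation unit_measure :: "real measure" where
  "unit_measure \<equiv> lebesgue_on {0..1}"

definition square_integrable :: "(real \<Rightarrow> real) \<Rightarrow> bool" where
  "square_integrable f \<longleftrightarrow>
     f \<in> borel_measurable unit_measure \<and> integrable unit_measure (\<lambda>x. (f x)\<^sup>2)"

lemma square_integrable_measurable [measurable_dest]:
  "square_integrable f \<Longrightarrow> f \<in> borel_measurable unit_measure"
  by (simp add: square_integrable_def)

lemma square_integrable_mult:
  assumes "square_integrable f" "square_integrable g"
  shows "integrable unit_measure (\<lambda>x. f x * g x)"
proof (rule Bochner_Integration.integrable_bound)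
  show "integrable unit_measure (\<lambda>x. (f x)\<^sup>2 + (g x)\<^sup>2)"
    using assms by (auto simp: square_integrable_def)
  show "(\<lambda>x. f x * g x) \<in> borel_measurable unit_measure"
    using assms by measurable
  have "\<bar>a * b\<bar> \<le> a\<^sup>2 + b\<^sup>2" for a b :: real
  proof -
    have "2 * \<bar>a * b\<bar> \<le> a\<^sup>2 + b\<^sup>2"
      using zero_le_power2[of "\<bar>a\<bar> - \<bar>b\<bar>"] by (simp add: power2_diff abs_mult)
    thus ?thesis by (smt (verit) sum_power2_ge_zero)
  qed
  then show "AE x in unit_measure. norm (f x * g x) \<le> norm ((f x)\<^sup>2 + (g x)\<^sup>2)"
    by (auto simp: abs_of_nonneg)
qed

lemma square_integrable_add:
  assumes "square_integrable f" "square_integrable g"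
  shows "square_integrable (\<lambda>x. f x + g x)"
  using assms square_integrable_mult[OF assms]
  by (auto simp: square_integrable_def power2_sum mult.assoc)

lemma square_integrable_scale:
  assumes "square_integrable f"
  shows "square_integrable (\<lambda>x. c * f x)"
  using assms by (auto simp: square_integrable_def power_mult_distrib)

lemma square_integrable_bounded:
  assumes "f \<in> borel_measurable unit_measure" "\<And>x. x \<in> {0..1} \<Longrightarrow> \<bar>f x\<bar> \<le> c"
  shows "square_integrable f"
proof -
  have "finite_measure unit_measure"
    by (rule finite_measureI) (simp add: emeasure_restrict_space space_restrict_space)
  then have "integrable unit_measure (\<lambda>x. (f x)\<^sup>2)"
    by (rule finite_measure.integrable_const_bound[where B = "c\<^sup>2"])
      (use assms in \<open>auto intro!: AE_I2 simp: space_restrict_space abs_le_square_iff[symmetric]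
          intro: order_trans[OF _ abs_ge_self]\<close>)
  with assms(1) show ?thesis by (simp add: square_integrable_def)
qed

definition L2_rel :: "(real \<Rightarrow> real) \<Rightarrow> (real \<Rightarrow> real) \<Rightarrow> bool" where
  "L2_rel f g \<longleftrightarrow> square_integrable f \<and> square_integrable g \<and> (AE x in unit_measure. f x = g x)"

quotient_type L2 = "real \<Rightarrow> real" / partial: L2_rel
proof (rule part_equivpI)
  show "\<exists>f. L2_rel f f"
    by (rule exI[of _ "\<lambda>_. 0"]) (simp add: L2_rel_def square_integrable_def)
  show "symp L2_rel" by (auto simp: symp_def L2_rel_def)
  show "transp L2_rel" by (auto simp: transp_def L2_rel_def)
qed

lemma square_integrable_rep [simp]: "square_integrable (rep_L2 v)"
  using Quotient_rep_reflp[OF Quotient_L2, of v] by (simp add: L2_rel_def)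

lemma abs_rep_L2 [simp]: "abs_L2 (rep_L2 v) = v"
  by (rule Quotient_abs_rep[OF Quotient_L2])

lemma abs_L2_eq_iff:
  "square_integrable f \<Longrightarrow> square_integrable g \<Longrightarrow>
     abs_L2 f = abs_L2 g \<longleftrightarrow> (AE x in unit_measure. f x = g x)"
  using Quotient_rel[OF Quotient_L2, of f g] by (auto simp: L2_rel_def)

lemma rep_abs_L2: "square_integrable f \<Longrightarrow> AE x in unit_measure. rep_L2 (abs_L2 f) x = f x"
  using abs_L2_eq_iff[of "rep_L2 (abs_L2 f)" f] by simp

instantiation L2 :: real_inner
begin

lift_definition zero_L2 :: L2 is "\<lambda>_. 0"
  by (simp add: L2_rel_def square_integrable_def)

lift_definition plus_L2 :: "L2 \<Rightarrow> L2 \<Rightarrow> L2" is "\<lambda>f g x. f x + g x"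
  by (auto simp: L2_rel_def intro: square_integrable_add)

lift_definition scaleR_L2 :: "real \<Rightarrow> L2 \<Rightarrow> L2" is "\<lambda>c f x. c * f x"
  by (auto simp: L2_rel_def intro: square_integrable_scale)

lift_definition inner_L2 :: "L2 \<Rightarrow> L2 \<Rightarrow> real"
  is "\<lambda>f g. integral\<^sup>L unit_measure (\<lambda>x. f x * g x)"
  by (rule integral_cong_AE) (auto simp: L2_rel_def elim!: AE_mp)

definition uminus_L2 :: "L2 \<Rightarrow> L2" where "uminus_L2 v = (-1) *\<^sub>R v"
definition minus_L2 :: "L2 \<Rightarrow> L2 \<Rightarrow> L2" where "minus_L2 v w = v + - w"
definition norm_L2 :: "L2 \<Rightarrow> real" where "norm_L2 v = sqrt (inner v v)"
definition sgn_L2 :: "L2 \<Rightarrow> L2" where "sgn_L2 v = inverse (norm v) *\<^sub>R v"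
definition dist_L2 :: "L2 \<Rightarrow> L2 \<Rightarrow> real" where "dist_L2 v w = norm (v - w)"
definition uniformity_L2 :: "(L2 \<times> L2) filter"
  where "uniformity_L2 = (INF e\<in>{0<..}. principal {(v, w). dist v w < e})"
definition open_L2 :: "L2 set \<Rightarrow> bool"
  where "open_L2 U \<longleftrightarrow> (\<forall>v\<in>U. eventually (\<lambda>(v', w). v' = v \<longrightarrow> w \<in> U) uniformity)"

instance
proof
  fix u v w :: L2 and a b :: real
  show "u + v + w = u + (v + w)"
    by transfer (auto simp: L2_rel_def algebra_simps intro!: square_integrable_add)
  show "u + v = v + u"
    by transfer (auto simp: L2_rel_def algebra_simps intro!: square_integrable_add)
  show "0 + u = u"
    by transfer (auto simp: L2_rel_def)
  have "(-1) *\<^sub>R u + u = 0"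
    by transfer (auto simp: L2_rel_def square_integrable_def)
  then show "- u + u = 0" by (simp add: uminus_L2_def)
  show "u - v = u + - v" by (simp add: minus_L2_def)
  show "a *\<^sub>R (u + v) = a *\<^sub>R u + a *\<^sub>R v"
    by transfer (auto simp: L2_rel_def algebra_simps
        intro!: square_integrable_add square_integrable_scale)
  show "(a + b) *\<^sub>R u = a *\<^sub>R u + b *\<^sub>R u"
    by transfer (auto simp: L2_rel_def algebra_simps
        intro!: square_integrable_add square_integrable_scale)
  show "a *\<^sub>R b *\<^sub>R u = (a * b) *\<^sub>R u"
    by transfer (auto simp: L2_rel_def algebra_simps
        intro!: square_integrable_add square_integrable_scale)
  show "1 *\<^sub>R u = u"
    by transfer (auto simp: L2_rel_def)
  show "inner u v = inner v u"
    by transfer (simp add: mult.commute)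
  show "inner (u + v) w = inner u w + inner v w"
    by transfer (auto simp: L2_rel_def distrib_right square_integrable_mult)
  show "inner (a *\<^sub>R u) v = a * inner u v"
    by transfer (auto simp: L2_rel_def mult.assoc)
  show "0 \<le> inner u u"
    by transfer simp
  show "inner u u = 0 \<longleftrightarrow> u = 0"
  proof transfer
    fix f assume "L2_rel f f"
    then have f: "square_integrable f" by (simp add: L2_rel_def)
    then have "integral\<^sup>L unit_measure (\<lambda>x. f x * f x) = 0 \<longleftrightarrow> (AE x in unit_measure. f x * f x = 0)"
      by (intro integral_nonneg_eq_0_iff_AE square_integrable_mult) auto
    with f show "integral\<^sup>L unit_measure (\<lambda>x. f x * f x) = 0 \<longleftrightarrow> L2_rel f (\<lambda>_. 0)"
      by (auto simp: L2_rel_def square_integrable_def)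
  qed
qed (simp_all add: norm_L2_def sgn_L2_def dist_L2_def uniformity_L2_def open_L2_def)

end

lemma inner_abs_L2:
  "square_integrable f \<Longrightarrow> square_integrable g \<Longrightarrow>
     inner (abs_L2 f) (abs_L2 g) = integral\<^sup>L unit_measure (\<lambda>x. f x * g x)"
  by (rule inner_L2.abs_eq) (simp_all add: L2_rel_def)

lemma norm_abs_L2:
  "square_integrable f \<Longrightarrow> (norm (abs_L2 f))\<^sup>2 = integral\<^sup>L unit_measure (\<lambda>x. (f x)\<^sup>2)"
  unfolding power2_norm_eq_inner by (simp add: inner_abs_L2, simp add: power2_eq_square)

lemma diff_abs_L2:
  assumes "square_integrable f" "square_integrable g"
  shows "abs_L2 f - abs_L2 g = abs_L2 (\<lambda>x. f x - g x)"
    and "square_integrable (\<lambda>x. f x - g x)"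
proof -
  have s: "square_integrable (\<lambda>x. (-1) * g x)" using assms by (intro square_integrable_scale)
  have "abs_L2 f + (-1) *\<^sub>R abs_L2 g = abs_L2 (\<lambda>x. f x + (-1) * g x)"
    using assms s by (subst scaleR_L2.abs_eq) (auto simp: L2_rel_def plus_L2.abs_eq)
  then show "abs_L2 f - abs_L2 g = abs_L2 (\<lambda>x. f x - g x)" by simp
  show "square_integrable (\<lambda>x. f x - g x)"
    using square_integrable_add[OF assms(1) s] by simp
qed

lemma L1_le_norm_L2:
  assumes "square_integrable f"
  shows "(\<integral>\<^sup>+x. ennreal \<bar>f x\<bar> \<partial>unit_measure) \<le> ennreal (norm (abs_L2 f))"
proof -
  have one: "square_integrable (\<lambda>_. 1)" by (rule square_integrable_bounded[of _ 1]) auto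
  have f: "square_integrable (\<lambda>x. \<bar>f x\<bar>)" using assms by (auto simp: square_integrable_def)
  have "integral\<^sup>L unit_measure (\<lambda>x. (1::real)) = 1"
    by (simp add: measure_restrict_space space_restrict_space)
  with norm_abs_L2[OF one] have n1: "norm (abs_L2 (\<lambda>_. 1)) = 1"
    by (simp add: power2_eq_1_iff) (smt (verit) norm_ge_zero)
  have "(norm (abs_L2 (\<lambda>x. \<bar>f x\<bar>)))\<^sup>2 = (norm (abs_L2 f))\<^sup>2"
    using norm_abs_L2[OF f] norm_abs_L2[OF assms] by simp
  then have nf: "norm (abs_L2 (\<lambda>x. \<bar>f x\<bar>)) = norm (abs_L2 f)" by simp
  have "integral\<^sup>L unit_measure (\<lambda>x. \<bar>f x\<bar>) = inner (abs_L2 (\<lambda>x. \<bar>f x\<bar>)) (abs_L2 (\<lambda>_. 1))"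
    using inner_abs_L2[OF f one] by simp
  also have "\<dots> \<le> norm (abs_L2 f)"
    using norm_cauchy_schwarz[of "abs_L2 (\<lambda>x. \<bar>f x\<bar>)" "abs_L2 (\<lambda>_. 1)"] n1 nf by simp
  finally show ?thesis
    using square_integrable_mult[OF f one]
    by (subst nn_integral_eq_integral) (auto intro: ennreal_leI)
qed

instance L2 :: complete_space
proof
  fix X :: "nat \<Rightarrow> L2"
  assume "Cauchy X"
  then have "\<exists>N. \<forall>m\<ge>N. \<forall>k\<ge>N. norm (X m - X k) < (1/2) ^ n" for n
    by (simp add: Cauchy_iff)
  then obtain N where N: "\<And>n m k. m \<ge> N n \<Longrightarrow> k \<ge> N n \<Longrightarrow> norm (X m - X k) < (1/2) ^ n"
    by metis
  define r where "r n = (\<Sum>i\<le>n. N i)" for n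
  have r: "r k \<ge> N n" if "k \<ge> n" for k n
    unfolding r_def using that by (intro member_le_sum) auto
  define F where "F m = rep_L2 (X m)" for m
  have F [simp]: "square_integrable (F m)" for m by (simp add: F_def)
  have XF: "X m = abs_L2 (F m)" for m by (simp add: F_def)
  have [measurable]: "F m \<in> borel_measurable unit_measure" for m
    using F[of m] by (simp add: square_integrable_def)
  define Y where "Y k = F (r k)" for k
  have [measurable]: "Y m \<in> borel_measurable unit_measure" for m by (simp add: Y_def)
  define f where "f x = lim (\<lambda>k. Y k x)" for x
  have [measurable]: "f \<in> borel_measurable unit_measure"
    unfolding f_def by measurable
  have "(\<integral>\<^sup>+x. (\<Sum>k. ennreal \<bar>Y (Suc k) x - Y k x\<bar>) \<partial>unit_measure) =
          (\<Sum>k. (\<integral>\<^sup>+x. ennreal \<bar>Y (Suc k) x - Y k x\<bar> \<partial>unit_measure))"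
    by (rule nn_integral_suminf) measurable
  also have "\<dots> \<le> (\<Sum>k. ennreal ((1/2) ^ k))"
  proof (intro suminf_le)
    fix k
    have "(\<integral>\<^sup>+x. ennreal \<bar>Y (Suc k) x - Y k x\<bar> \<partial>unit_measure) \<le> ennreal (norm (X (r (Suc k)) - X (r k)))"
      using L1_le_norm_L2[OF diff_abs_L2(2), OF F F] by (simp add: Y_def XF diff_abs_L2(1))
    also have "\<dots> \<le> ennreal ((1/2) ^ k)"
      by (intro ennreal_leI less_imp_le[OF N] r) auto
    finally show "(\<integral>\<^sup>+x. ennreal \<bar>Y (Suc k) x - Y k x\<bar> \<partial>unit_measure) \<le> ennreal ((1/2) ^ k)" .
  qed auto
  also have "\<dots> = ennreal (\<Sum>k. (1/2) ^ k)"
    by (rule suminf_ennreal2) (auto intro: summable_geometric)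
  also have "\<dots> < \<infinity>" by simp
  finally have "AE x in unit_measure. (\<Sum>k. ennreal \<bar>Y (Suc k) x - Y k x\<bar>) \<noteq> \<infinity>"
    by (intro nn_integral_noteq_infinite) simp_all
  then have lim: "AE x in unit_measure. (\<lambda>k. Y k x) \<longlonglongrightarrow> f x"
  proof (rule AE_mp, intro AE_I2 impI)
    fix x assume "(\<Sum>k. ennreal \<bar>Y (Suc k) x - Y k x\<bar>) \<noteq> \<infinity>"
    then have "summable (\<lambda>k. \<bar>Y (Suc k) x - Y k x\<bar>)"
      by (intro summable_suminf_not_top) auto
    then have "summable (\<lambda>k. Y (Suc k) x - Y k x)"
      by (rule summable_rabs_cancel)
    then have "convergent (\<lambda>n. \<Sum>k<n. Y (Suc k) x - Y k x)"
      by (simp add: summable_iff_convergent)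
    then have "convergent (\<lambda>n. Y n x - Y 0 x)"
      by (simp only: sum_lessThan_telescope[of "\<lambda>k. Y k x"])
    then obtain l where "(\<lambda>n. Y n x - Y 0 x) \<longlonglongrightarrow> l" by (auto simp: convergent_def)
    then have "(\<lambda>n. (Y n x - Y 0 x) + Y 0 x) \<longlonglongrightarrow> l + Y 0 x" by (intro tendsto_intros)
    then have "convergent (\<lambda>n. Y n x)" by (auto simp: convergent_def)
    then show "(\<lambda>k. Y k x) \<longlonglongrightarrow> f x" by (simp add: f_def convergent_LIMSEQ_iff)
  qed
  have bound: "(\<integral>\<^sup>+x. ennreal ((F m x - f x)\<^sup>2) \<partial>unit_measure) \<le> ennreal (((1/2) ^ n)\<^sup>2)"
    if m: "m \<ge> N n" for m n
  proof -
    have "(\<integral>\<^sup>+x. ennreal ((F m x - f x)\<^sup>2) \<partial>unit_measure) =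
          (\<integral>\<^sup>+x. liminf (\<lambda>k. ennreal ((F m x - Y k x)\<^sup>2)) \<partial>unit_measure)"
    proof (rule nn_integral_cong_AE, rule AE_mp[OF lim], intro AE_I2 impI)
      fix x assume "(\<lambda>k. Y k x) \<longlonglongrightarrow> f x"
      then have "(\<lambda>k. ennreal ((F m x - Y k x)\<^sup>2)) \<longlonglongrightarrow> ennreal ((F m x - f x)\<^sup>2)"
        by (intro tendsto_intros tendsto_ennrealI)
      then show "ennreal ((F m x - f x)\<^sup>2) = liminf (\<lambda>k. ennreal ((F m x - Y k x)\<^sup>2))"
        by (intro lim_imp_Liminf[symmetric]) simp_all
    qed
    also have "\<dots> \<le> liminf (\<lambda>k. \<integral>\<^sup>+x. ennreal ((F m x - Y k x)\<^sup>2) \<partial>unit_measure)"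
      by (rule nn_integral_liminf) measurable
    also have "\<dots> \<le> liminf (\<lambda>k. ennreal (((1/2) ^ n)\<^sup>2))"
    proof (rule Liminf_mono, rule eventually_sequentiallyI[of n])
      fix k assume k: "k \<ge> n"
      have i: "integrable unit_measure (\<lambda>x. (F m x - Y k x)\<^sup>2)"
        using diff_abs_L2(2)[OF F F] by (simp add: Y_def square_integrable_def)
      have "(norm (X m - X (r k)))\<^sup>2 = integral\<^sup>L unit_measure (\<lambda>x. (F m x - Y k x)\<^sup>2)"
        using norm_abs_L2[OF diff_abs_L2(2), OF F F] by (simp add: XF diff_abs_L2(1) Y_def)
      moreover have "(norm (X m - X (r k)))\<^sup>2 \<le> ((1/2) ^ n)\<^sup>2"
        by (intro power_mono less_imp_le[OF N] m r k) auto
      ultimately show "(\<integral>\<^sup>+x. ennreal ((F m x - Y k x)\<^sup>2) \<partial>unit_measure) \<le> ennreal (((1/2) ^ n)\<^sup>2)"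
        using i by (subst nn_integral_eq_integral) (auto intro: ennreal_leI)
    qed
    also have "\<dots> = ennreal (((1/2) ^ n)\<^sup>2)" by (simp add: Liminf_const)
    finally show ?thesis .
  qed
  have si: "square_integrable (\<lambda>x. F m x - f x)" if "m \<ge> N n" for m n
    using le_less_trans[OF bound[OF that]] by (simp add: square_integrable_def integrable_iff_bounded)
  have "square_integrable f"
    using diff_abs_L2(2)[OF F si[OF order_refl, of 0], of "N 0"] by simp
  have *: "norm (X m - abs_L2 f) \<le> (1/2) ^ n" if m: "m \<ge> N n" for m n
  proof -
    have "ennreal ((norm (X m - abs_L2 f))\<^sup>2) = (\<integral>\<^sup>+x. ennreal ((F m x - f x)\<^sup>2) \<partial>unit_measure)"
      using si[OF m] norm_abs_L2[OF si[OF m]] diff_abs_L2(1)[OF F \<open>square_integrable f\<close>]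
      by (subst nn_integral_eq_integral) (auto simp: XF square_integrable_def)
    also note bound[OF m]
    finally have "(norm (X m - abs_L2 f))\<^sup>2 \<le> ((1/2) ^ n)\<^sup>2" by simp
    then show ?thesis by (rule power2_le_imp_le) simp
  qed
  have "X \<longlonglongrightarrow> abs_L2 f"
  proof (rule LIMSEQ_I)
    fix e :: real assume "e > 0"
    then obtain n where "(1/2) ^ n < e" using real_arch_pow_inv[of e "1/2"] by auto
    then show "\<exists>no. \<forall>m\<ge>no. norm (X m - abs_L2 f) < e"
      using * by (meson le_less_trans)
  qed
  then show "convergent X" by (auto simp: convergent_def)
qed

section \<open>Schreier graphs of actions on Hilbert spaces\<close>

text \<open>An arrow from \<open>v\<close> to \<open>w\<close> labelled \<open>s\<close> is the triple \<open>(v, s, w)\<close>.\<close>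

definition schreier_graph ::
  "('g \<Rightarrow> 'h \<Rightarrow> 'h::{real_inner, complete_space}) \<Rightarrow> 'h set \<Rightarrow> 'g set \<Rightarrow> ('h, 'h \<times> 'g \<times> 'h) pre_digraph"
  where
  "schreier_graph \<pi> B S =
     \<lparr>verts = B,
      arcs = {(v, s, w). v \<in> B \<and> s \<in> S \<and> w \<in> B \<and> inner (\<pi> s v) w \<noteq> 0},
      tail = (\<lambda>(v, s, w). v),
      head = (\<lambda>(v, s, w). w)\<rparr>"


section \<open>Thompson's group\<close>

text \<open>The set \<open>P\<close> contains the points of non-differentiability: on every closed interval whose
  interior avoids \<open>P\<close> the map is affine with slope an integer power of two.\<close>

definition dyadic_piecewise_linear :: "(real \<Rightarrow> real) \<Rightarrow> bool" where
  "dyadic_piecewise_linear g \<longleftrightarrow>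
     (\<exists>P. finite P \<and> P \<subseteq> dyadics \<and>
        (\<forall>a b. 0 \<le> a \<and> a < b \<and> b \<le> 1 \<and> {a<..<b} \<inter> P = {} \<longrightarrow>
           (\<exists>(k::int) c. \<forall>x\<in>{a..b}. g x = 2 powi k * x + c)))"

definition thompson_F :: "(real \<Rightarrow> real) monoid" where
  "thompson_F = (BijGroup {0..1})
     \<lparr>carrier := {g \<in> Bij {0..1}. homeomorphism {0..1} {0..1} g (inv_into {0..1} g) \<and>
        strict_mono_on {0..1} g \<and> dyadic_piecewise_linear g}\<rparr>"

definition thompson_x0 :: "real \<Rightarrow> real" where
  "thompson_x0 = (\<lambda>t\<in>{0..1}.
     if t \<le> 1/2 then t / 2
     else if t \<le> 3/4 then t - 1/4
     else 2 * t - 1)"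

definition thompson_x1 :: "real \<Rightarrow> real" where
  "thompson_x1 = (\<lambda>t\<in>{0..1}.
     if t \<le> 1/2 then t
     else if t \<le> 3/4 then t / 2 + 1/4
     else if t \<le> 7/8 then t - 1/8
     else 2 * t - 1)"

lemma dyadics_add:
  assumes "x \<in> dyadics" "y \<in> dyadics" shows "x + y \<in> (dyadics :: real set)"
proof -
  obtain m k n l where "x = real m / 2^k" "y = real n / 2^l"
    using assms by (auto simp: dyadics_def)
  then have "x + y = real (m * 2^l + n * 2^k) / 2^(k + l)"
    by (simp only:) (simp add: field_simps power_add)
  then show ?thesis unfolding dyadics_def by blast
qed

lemma dyadics_diff:
  assumes "x \<in> dyadics" "y \<in> dyadics" "y \<le> x" shows "x - y \<in> (dyadics :: real set)"
proof -
  obtain m k n l where xy: "x = real m / 2^k" "y = real n / 2^l"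
    using assms by (auto simp: dyadics_def)
  have "real (n * 2^k) \<le> real (m * 2^l)"
    using \<open>y \<le> x\<close> by (simp add: xy field_simps)
  then have "n * 2^k \<le> m * 2^l" by (simp only: of_nat_le_iff)
  then have "x - y = real (m * 2^l - n * 2^k) / 2^(k + l)"
    by (simp add: xy field_simps power_add of_nat_diff)
  then show ?thesis unfolding dyadics_def by blast
qed

lemma dyadics_powi:
  assumes "x \<in> dyadics" shows "2 powi k * x \<in> (dyadics :: real set)"
proof -
  obtain m n where x: "x = real m / 2^n"
    using assms by (auto simp: dyadics_def)
  show ?thesis
  proof (cases "k \<ge> 0")
    case True
    then have "2 powi k * x = real (2 ^ nat k * m) / 2^n" by (simp add: x power_int_def)
    then show ?thesis unfolding dyadics_def by blast
  next
    case False
    then have "2 powi k * x = real m / 2^(n + nat (-k))"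
      by (simp add: x power_int_def power_add field_simps)
    then show ?thesis unfolding dyadics_def by blast
  qed
qed

lemma thompson_carrierD:
  assumes "g \<in> carrier thompson_F"
  shows "g \<in> Bij {0..1}" "strict_mono_on {0..1} g" "continuous_on {0..1} g"
    "dyadic_piecewise_linear g" "g ` {0..1} = {0..1}" "g 0 = 0" "g 1 = 1"
proof -
  show g: "g \<in> Bij {0..1}" and m: "strict_mono_on {0..1} g" and "dyadic_piecewise_linear g"
    and "continuous_on {0..1} g"
    using assms by (auto simp: thompson_F_def homeomorphism_def)
  show im: "g ` {0..1} = {0..1}" using g by (auto simp: Bij_def bij_betw_def)
  have mono: "g x \<le> g y" if "x \<in> {0..1}" "y \<in> {0..1}" "x \<le> y" for x y
    using strict_mono_onD[OF m, of x y] that by (cases "x = y") auto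
  have "0 \<in> g ` {0..1}" "1 \<in> g ` {0..1}" using im by auto
  then obtain u v where uv: "u \<in> {0..1}" "g u = 0" "v \<in> {0..1}" "g v = 1" by (metis imageE)
  have "g 0 \<in> {0..1}" "g 1 \<in> {0..1}" using im by force+
  then show "g 0 = 0" "g 1 = 1"
    using mono[of 0 u] mono[of v 1] uv by auto
qed

lemma thompson_carrierI:
  assumes "g \<in> Bij {0..1}" "strict_mono_on {0..1} g" "continuous_on {0..1} g"
    "dyadic_piecewise_linear g"
  shows "g \<in> carrier thompson_F"
proof -
  have im: "g ` {0..1} = {0..1}" and inj: "inj_on g {0..1}"
    using assms(1) by (auto simp: Bij_def bij_betw_def)
  obtain h where h: "homeomorphism {0..1} {0..1} g h"
    using homeomorphism_compact[OF compact_Icc assms(3) im inj] by blast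
  have "h y = inv_into {0..1} g y" if "y \<in> {0..1}" for y
    using h inj that im
    by (intro inv_into_f_eq[symmetric]) (auto simp: homeomorphism_def)
  then have "homeomorphism {0..1} {0..1} g (inv_into {0..1} g)"
    using homeomorphism_cong[OF h refl refl] by auto
  with assms show ?thesis by (simp add: thompson_F_def)
qed

lemma thompson_dyadics:
  assumes g: "g \<in> carrier thompson_F" and x: "x \<in> {0..1}"
  shows "g x \<in> dyadics \<longleftrightarrow> x \<in> dyadics"
proof -
  note D = thompson_carrierD[OF g]
  obtain P where P: "finite P" "P \<subseteq> dyadics"
    and lin: "\<And>a b. 0 \<le> a \<Longrightarrow> a < b \<Longrightarrow> b \<le> 1 \<Longrightarrow> {a<..<b} \<inter> P = {} \<Longrightarrow>
           (\<exists>(k::int) c. \<forall>x\<in>{a..b}. g x = 2 powi k * x + c)"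
    using D(4) unfolding dyadic_piecewise_linear_def by metis
  show ?thesis using x
  proof (induction "card (P \<inter> {0<..<x})" arbitrary: x rule: less_induct)
    case less
    show ?case
    proof (cases "x = 0")
      case True then show ?thesis using D by simp
    next
      case False
      define Q where "Q = insert 0 (P \<inter> {0<..<x})"
      have Q: "finite Q" "Q \<noteq> {}" using P by (auto simp: Q_def)
      define a where "a = Max Q"
      have aQ: "a \<in> Q" using Q by (simp add: a_def)
      have ad: "a \<in> dyadics" using aQ P real_in_dyadics[of 0] by (auto simp: Q_def)
      have ax: "0 \<le> a" "a < x" using aQ False less.prems by (auto simp: Q_def)
      have ga: "g a \<in> dyadics"
      proof (cases "a = 0")
        case True then show ?thesis using D ad by simp
      next
        case False
        then have "P \<inter> {0<..<a} \<subset> P \<inter> {0<..<x}"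
          using aQ ax by (auto simp: Q_def)
        then have "card (P \<inter> {0<..<a}) < card (P \<inter> {0<..<x})"
          using P by (intro psubset_card_mono) auto
        then show ?thesis using less.hyps[of a] ax less.prems ad by auto
      qed
      have "p \<le> a" if "p \<in> P" "a < p" "p < x" for p
        unfolding a_def using Q that ax by (intro Max_ge) (auto simp: Q_def)
      then have "{a<..<x} \<inter> P = {}" by force
      then obtain k c where "\<forall>y\<in>{a..x}. g y = 2 powi k * y + c"
        using lin[of a x] ax less.prems by auto
      then have eq: "g x - g a = 2 powi k * (x - a)"
        using ax by (simp add: algebra_simps)
      have "g a < g x" using D(2) ax less.prems by (auto simp: strict_mono_on_def)
      have "x - a = 2 powi (-k) * (g x - g a)"
        by (simp add: eq power_int_minus)
      show ?thesis
      proof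
        assume "x \<in> dyadics"
        then have "2 powi k * (x - a) \<in> dyadics"
          using ad ax by (intro dyadics_powi dyadics_diff) auto
        from dyadics_add[OF this ga] show "g x \<in> dyadics" by (simp flip: eq)
      next
        assume "g x \<in> dyadics"
        then have "2 powi (-k) * (g x - g a) \<in> dyadics"
          using ga \<open>g a < g x\<close> by (intro dyadics_powi dyadics_diff) auto
        from dyadics_add[OF this ad] show "x \<in> dyadics"
          by (simp flip: \<open>x - a = 2 powi (-k) * (g x - g a)\<close>)
      qed
    qed
  qed
qed

lemma dyadic_piecewise_linearE:
  assumes "dyadic_piecewise_linear g"
  obtains P where "finite P" "P \<subseteq> dyadics \<inter> {0..1}"
    and "\<And>a b. 0 \<le> a \<Longrightarrow> a < b \<Longrightarrow> b \<le> 1 \<Longrightarrow> {a<..<b} \<inter> P = {} \<Longrightarrow>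
           (\<exists>(k::int) c. \<forall>x\<in>{a..b}. g x = 2 powi k * x + c)"
proof -
  obtain P where P: "finite P" "P \<subseteq> dyadics"
    and lin: "\<And>a b. 0 \<le> a \<Longrightarrow> a < b \<Longrightarrow> b \<le> 1 \<Longrightarrow> {a<..<b} \<inter> P = {} \<Longrightarrow>
           (\<exists>(k::int) c. \<forall>x\<in>{a..b}. g x = 2 powi k * x + c)"
    using assms unfolding dyadic_piecewise_linear_def by metis
  have "{a<..<b} \<inter> P = {}" if "0 \<le> a" "b \<le> 1" "{a<..<b} \<inter> (P \<inter> {0..1}) = {}" for a b
    using that by fastforce
  then show thesis using P lin by (intro that[of "P \<inter> {0..1}"]) auto
qed

lemma thompson_inverse_closed:
  assumes g: "g \<in> carrier thompson_F"
  shows "(\<lambda>x\<in>{0..1}. inv_into {0..1} g x) \<in> carrier thompson_F" (is "?h \<in> _")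
proof (rule thompson_carrierI)
  note D = thompson_carrierD[OF g]
  have inj: "inj_on g {0..1}" using D(1) by (auto simp: Bij_def bij_betw_def)
  have h: "?h y \<in> {0..1}" "g (?h y) = y" if "y \<in> {0..1}" for y
    using that D(5) by (auto simp: f_inv_into_f) (metis inv_into_into atLeastAtMost_iff)+
  show "?h \<in> Bij {0..1}" by (rule restrict_inv_into_Bij[OF D(1)])
  show mono: "strict_mono_on {0..1} ?h"
  proof (rule strict_mono_onI)
    fix r s :: real assume rs: "r \<in> {0..1}" "s \<in> {0..1}" "r < s"
    show "?h r < ?h s"
    proof (rule ccontr)
      assume "\<not> ?h r < ?h s"
      then have "g (?h s) \<le> g (?h r)"
        using strict_mono_onD[OF D(2) h(1)[OF rs(2)] h(1)[OF rs(1)]]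
        by (cases "?h s = ?h r") auto
      then show False using h(2)[OF rs(1)] h(2)[OF rs(2)] rs by linarith
    qed
  qed
  have "homeomorphism {0..1} {0..1} g (inv_into {0..1} g)"
    using g by (simp add: thompson_F_def)
  then show "continuous_on {0..1} ?h"
    by (subst continuous_on_cong[OF refl, of _ _ "inv_into {0..1} g"]) (auto simp: homeomorphism_def)
  obtain P where P: "finite P" "P \<subseteq> dyadics \<inter> {0..1}"
    and lin: "\<And>a b. 0 \<le> a \<Longrightarrow> a < b \<Longrightarrow> b \<le> 1 \<Longrightarrow> {a<..<b} \<inter> P = {} \<Longrightarrow>
           (\<exists>(k::int) c. \<forall>x\<in>{a..b}. g x = 2 powi k * x + c)"
    using dyadic_piecewise_linearE[OF D(4)] by metis
  show "dyadic_piecewise_linear ?h"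
    unfolding dyadic_piecewise_linear_def
  proof (intro exI[of _ "g ` P"] conjI allI impI)
    show "finite (g ` P)" using P by simp
    show "g ` P \<subseteq> dyadics" using P thompson_dyadics[OF g] by blast
    fix a b :: real assume ab: "0 \<le> a \<and> a < b \<and> b \<le> 1 \<and> {a<..<b} \<inter> g ` P = {}"
    then have ab': "a \<in> {0..1}" "b \<in> {0..1}" "a < b" by auto
    have "{?h a<..<?h b} \<inter> P = {}"
    proof (rule equals0I)
      fix p assume p: "p \<in> {?h a<..<?h b} \<inter> P"
      then have "p \<in> {0..1}" using P by auto
      then have "a < g p" "g p < b"
        using strict_mono_onD[OF D(2), of "?h a" p] strict_mono_onD[OF D(2), of p "?h b"]
          h[OF ab'(1)] h[OF ab'(2)] p by auto
      then show False using ab p by auto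
    qed
    moreover have "?h a < ?h b" using strict_mono_onD[OF mono] ab' by blast
    ultimately obtain k c where kc: "\<forall>x\<in>{?h a..?h b}. g x = 2 powi k * x + c"
      using lin[of "?h a" "?h b"] h(1)[OF ab'(1)] h(1)[OF ab'(2)] by (metis atLeastAtMost_iff)
    have "?h y = 2 powi (-k) * y + (- (2 powi (-k)) * c)" if y: "y \<in> {a..b}" for y
    proof -
      have y01: "y \<in> {0..1}" using y ab by auto
      have "?h a \<le> ?h y" "?h y \<le> ?h b"
        using strict_mono_onD[OF mono, of a y] strict_mono_onD[OF mono, of y b] y y01 ab'
        by (cases "a = y"; cases "y = b"; auto)+
      then have "y = 2 powi k * ?h y + c"
        using kc h(2)[OF y01] by (metis atLeastAtMost_iff)
      then have "2 powi (-k) * (y - c) = ?h y"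
        by (metis (no_types) add_diff_cancel_right' mult.assoc mult.left_neutral
            power_int_minus left_inverse power_int_not_zero zero_neq_numeral)
      then show ?thesis by (simp add: algebra_simps)
    qed
    then show "\<exists>(k::int) c. \<forall>x\<in>{a..b}. ?h x = 2 powi k * x + c" by blast
  qed
qed

lemma thompson_compose_closed:
  assumes g: "g \<in> carrier thompson_F" and h: "h \<in> carrier thompson_F"
  shows "compose {0..1} g h \<in> carrier thompson_F" (is "?f \<in> _")
proof (rule thompson_carrierI)
  note G = thompson_carrierD[OF g] and H = thompson_carrierD[OF h]
  have h01: "h x \<in> {0..1}" if "x \<in> {0..1}" for x using H(5) that by blast
  have f: "?f x = g (h x)" if "x \<in> {0..1}" for x using that by (simp add: compose_def)
  have hm: "h x < h y" if "x \<in> {0..1}" "y \<in> {0..1}" "x < y" for x y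
    using strict_mono_onD[OF H(2)] that by blast
  show "?f \<in> Bij {0..1}" using G(1) H(1) by (rule compose_Bij)
  show "strict_mono_on {0..1} ?f"
  proof (rule strict_mono_onI)
    fix r s :: real assume rs: "r \<in> {0..1}" "s \<in> {0..1}" "r < s"
    show "?f r < ?f s"
      using strict_mono_onD[OF G(2) h01[OF rs(1)] h01[OF rs(2)] hm[OF rs]] f rs by simp
  qed
  have "continuous_on {0..1} (g \<circ> h)"
    using G(3) H(3) H(5) by (intro continuous_on_compose) auto
  then show "continuous_on {0..1} ?f"
    by (subst continuous_on_cong[OF refl, of _ _ "g \<circ> h"]) (auto simp: compose_def)
  obtain P where P: "finite P" "P \<subseteq> dyadics \<inter> {0..1}"
    and linP: "\<And>a b. 0 \<le> a \<Longrightarrow> a < b \<Longrightarrow> b \<le> 1 \<Longrightarrow> {a<..<b} \<inter> P = {} \<Longrightarrow>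
           (\<exists>(k::int) c. \<forall>x\<in>{a..b}. g x = 2 powi k * x + c)"
    using dyadic_piecewise_linearE[OF G(4)] by metis
  obtain Q where Q: "finite Q" "Q \<subseteq> dyadics \<inter> {0..1}"
    and linQ: "\<And>a b. 0 \<le> a \<Longrightarrow> a < b \<Longrightarrow> b \<le> 1 \<Longrightarrow> {a<..<b} \<inter> Q = {} \<Longrightarrow>
           (\<exists>(k::int) c. \<forall>x\<in>{a..b}. h x = 2 powi k * x + c)"
    using dyadic_piecewise_linearE[OF H(4)] by metis
  have inj: "inj_on h {0..1}" using H(1) by (auto simp: Bij_def bij_betw_def)
  define R where "R = Q \<union> {x \<in> {0..1}. h x \<in> P}"
  show "dyadic_piecewise_linear ?f"
    unfolding dyadic_piecewise_linear_def
  proof (intro exI[of _ R] conjI allI impI)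
    have "finite (h -` P \<inter> {0..1})" by (rule finite_vimage_IntI[OF P(1) inj])
    moreover have "{x \<in> {0..1}. h x \<in> P} = h -` P \<inter> {0..1}" by auto
    ultimately show "finite R" using Q by (simp add: R_def)
    show "R \<subseteq> dyadics" using P Q thompson_dyadics[OF h] by (auto simp: R_def)
    fix a b :: real assume ab: "0 \<le> a \<and> a < b \<and> b \<le> 1 \<and> {a<..<b} \<inter> R = {}"
    then have ab': "a \<in> {0..1}" "b \<in> {0..1}" "a < b" by auto
    have "{a<..<b} \<inter> Q = {}" using ab by (auto simp: R_def)
    then obtain k c where kc: "\<forall>x\<in>{a..b}. h x = 2 powi k * x + c"
      using linQ[of a b] ab by auto
    have "{h a<..<h b} \<inter> P = {}"
    proof (rule equals0I)
      fix p assume p: "p \<in> {h a<..<h b} \<inter> P"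
      then have "p \<in> h ` {0..1}" using P H(5) by auto
      then obtain x where x: "x \<in> {0..1}" "p = h x" by blast
      have "a < x" "x < b"
        using hm[of x a] hm[of b x] x p ab' by (cases x a rule: linorder_cases; cases x b rule: linorder_cases; auto)+
      then show False using ab p x by (auto simp: R_def)
    qed
    then obtain l d where ld: "\<forall>y\<in>{h a..h b}. g y = 2 powi l * y + d"
      using linP[of "h a" "h b"] h01[OF ab'(1)] h01[OF ab'(2)] hm[OF ab'] by (metis atLeastAtMost_iff)
    have "?f x = 2 powi (l + k) * x + (2 powi l * c + d)" if x: "x \<in> {a..b}" for x
    proof -
      have x01: "x \<in> {0..1}" using x ab by auto
      have "h a \<le> h x" "h x \<le> h b"
        using hm[of a x] hm[of x b] x x01 ab' by (cases "a = x"; cases "x = b"; auto)+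
      then have "g (h x) = 2 powi l * h x + d" using ld by auto
      then show ?thesis using kc x f[OF x01] by (simp add: power_int_add algebra_simps)
    qed
    then show "\<exists>(k::int) c. \<forall>x\<in>{a..b}. ?f x = 2 powi k * x + c" by blast
  qed
qed

lemma subgroup_thompson_F: "subgroup (carrier thompson_F) (BijGroup {0..1})"
proof
  show "carrier thompson_F \<subseteq> carrier (BijGroup {0..1})"
    by (auto simp: thompson_F_def BijGroup_def)
  show "x \<otimes>\<^bsub>BijGroup {0..1}\<^esub> y \<in> carrier thompson_F"
    if "x \<in> carrier thompson_F" "y \<in> carrier thompson_F" for x y
    using thompson_compose_closed[OF that] thompson_carrierD(1)[OF that(1)]
      thompson_carrierD(1)[OF that(2)] by (simp add: BijGroup_def)
  show "\<one>\<^bsub>BijGroup {0..1}\<^esub> \<in> carrier thompson_F"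
  proof (rule thompson_carrierI)
    have one: "\<one>\<^bsub>BijGroup {0..1::real}\<^esub> = (\<lambda>x\<in>{0..1}. x)" by (simp add: BijGroup_def)
    show "dyadic_piecewise_linear \<one>\<^bsub>BijGroup {0..1}\<^esub>"
      unfolding dyadic_piecewise_linear_def one
      by (intro exI[of _ "{}"]) (auto intro!: exI[of _ "0::int"] exI[of _ "0::real"])
    have "continuous_on {0..1::real} (\<lambda>x\<in>{0..1}. x)"
      by (subst continuous_on_cong[OF refl, of _ _ "\<lambda>x. x"]) auto
    then show "continuous_on {0..1} \<one>\<^bsub>BijGroup {0..1::real}\<^esub>" by (simp add: BijGroup_def)
  qed (auto simp: BijGroup_def id_Bij strict_mono_on_def)
  show "inv\<^bsub>BijGroup {0..1}\<^esub> x \<in> carrier thompson_F" if "x \<in> carrier thompson_F" for x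
    using thompson_inverse_closed[OF that] inv_BijGroup[OF thompson_carrierD(1)[OF that]] by simp
qed

lemma thompson_F_eq: "thompson_F = (BijGroup {0..1})\<lparr>carrier := carrier thompson_F\<rparr>"
  by (simp add: thompson_F_def)

lemma group_thompson_F: "group thompson_F"
  using subgroup.subgroup_is_group[OF subgroup_thompson_F group_BijGroup]
  by (simp flip: thompson_F_eq)

lemma inv_thompson_F:
  assumes "g \<in> carrier thompson_F"
  shows "inv\<^bsub>thompson_F\<^esub> g = (\<lambda>x\<in>{0..1}. inv_into {0..1} g x)"
proof -
  have "inv\<^bsub>thompson_F\<^esub> g = inv\<^bsub>BijGroup {0..1}\<^esub> g"
    using group.m_inv_consistent[OF group_BijGroup subgroup_thompson_F assms]
    by (simp flip: thompson_F_eq)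
  then show ?thesis using inv_BijGroup[OF thompson_carrierD(1)[OF assms]] by simp
qed

lemma dyadic_breakpoints: "1/2 \<in> (dyadics :: real set)" "3/4 \<in> (dyadics :: real set)"
  "7/8 \<in> (dyadics :: real set)"
proof -
  have "real 1 / 2 ^ 1 \<in> dyadics" "real 3 / 2 ^ 2 \<in> dyadics" "real 7 / 2 ^ 3 \<in> dyadics"
    unfolding dyadics_def by blast+
  then show "1/2 \<in> (dyadics :: real set)" "3/4 \<in> (dyadics :: real set)" "7/8 \<in> (dyadics :: real set)"
    by simp_all
qed

lemma thompson_carrierI':
  assumes ext: "g \<in> extensional {0..1}" and mono: "strict_mono_on {0..1} g"
    and cont: "continuous_on {0..1} g" and "g 0 = 0" "g 1 = 1" "dyadic_piecewise_linear g"
  shows "g \<in> carrier thompson_F"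
proof (rule thompson_carrierI)
  have le: "g x \<le> g y" if "x \<in> {0..1}" "y \<in> {0..1}" "x \<le> y" for x y
    using strict_mono_onD[OF mono, of x y] that by (cases "x = y") auto
  have "y \<in> g ` {0..1}" if "y \<in> {0..1}" for y
    using IVT'[of g 0 y 1] cont that assms by auto
  moreover have "g x \<in> {0..1}" if "x \<in> {0..1}" for x
    using le[of 0 x] le[of x 1] that assms by auto
  ultimately have "g ` {0..1} = {0..1}" by blast
  moreover have "inj_on g {0..1}"
    using mono by (rule strict_mono_on_imp_inj_on)
  ultimately show "g \<in> Bij {0..1}" using ext by (auto simp: Bij_def bij_betw_def)
qed (use assms in auto)

lemma dyadic_piecewise_linearI:
  assumes "finite P" "P \<subseteq> dyadics"
    "\<And>a b. 0 \<le> a \<Longrightarrow> a < b \<Longrightarrow> b \<le> 1 \<Longrightarrow> (\<And>p. p \<in> P \<Longrightarrow> p \<le> a \<or> b \<le> p) \<Longrightarrow>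
       \<exists>(k::int) c. \<forall>x\<in>{a..b}. g x = 2 powi k * x + c"
  shows "dyadic_piecewise_linear g"
  unfolding dyadic_piecewise_linear_def
proof (intro exI[of _ P] conjI allI impI assms(1,2))
  fix a b :: real assume ab: "0 \<le> a \<and> a < b \<and> b \<le> 1 \<and> {a<..<b} \<inter> P = {}"
  then have "p \<le> a \<or> b \<le> p" if "p \<in> P" for p using that by force
  then show "\<exists>(k::int) c. \<forall>x\<in>{a..b}. g x = 2 powi k * x + c" using assms(3) ab by blast
qed

lemma thompson_x0_in_F: "thompson_x0 \<in> carrier thompson_F"
proof (rule thompson_carrierI')
  let ?g = "\<lambda>t::real. max (t / 2) (max (t - 1/4) (2 * t - 1))"
  have "continuous_on {0..1} ?g" by (intro continuous_intros) auto
  then show "continuous_on {0..1} thompson_x0"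
    by (subst continuous_on_cong[OF refl, of _ _ ?g]) (auto simp: thompson_x0_def)
  show "dyadic_piecewise_linear thompson_x0"
  proof (rule dyadic_piecewise_linearI[of "{1/2, 3/4}"])
    fix a b :: real
    assume ab: "0 \<le> a" "a < b" "b \<le> 1" "\<And>p. p \<in> {1/2, 3/4} \<Longrightarrow> p \<le> a \<or> b \<le> p"
    consider "b \<le> 1/2" | "1/2 \<le> a" "b \<le> 3/4" | "3/4 \<le> a"
      using ab(4)[of "1/2"] ab(4)[of "3/4"] by auto
    then show "\<exists>(k::int) c. \<forall>x\<in>{a..b}. thompson_x0 x = 2 powi k * x + c"
    proof cases
      case 1
      then show ?thesis using ab
        by (intro exI[of _ "-1"] exI[of _ "0"]) (auto simp: thompson_x0_def)
    next
      case 2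
      then show ?thesis using ab
        by (intro exI[of _ "0"] exI[of _ "-1/4"]) (auto simp: thompson_x0_def)
    next
      case 3
      then show ?thesis using ab
        by (intro exI[of _ "1"] exI[of _ "-1"]) (auto simp: thompson_x0_def)
    qed
  qed (auto simp: dyadic_breakpoints)
qed (auto simp: thompson_x0_def strict_mono_on_def)

lemma thompson_x1_in_F: "thompson_x1 \<in> carrier thompson_F"
proof (rule thompson_carrierI')
  let ?g = "\<lambda>t::real. min t (max (t / 2 + 1/4) (max (t - 1/8) (2 * t - 1)))"
  have "continuous_on {0..1} ?g" by (intro continuous_intros) auto
  then show "continuous_on {0..1} thompson_x1"
    by (subst continuous_on_cong[OF refl, of _ _ ?g]) (auto simp: thompson_x1_def)
  show "dyadic_piecewise_linear thompson_x1"
  proof (rule dyadic_piecewise_linearI[of "{1/2, 3/4, 7/8}"])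
    fix a b :: real
    assume ab: "0 \<le> a" "a < b" "b \<le> 1" "\<And>p. p \<in> {1/2, 3/4, 7/8} \<Longrightarrow> p \<le> a \<or> b \<le> p"
    consider "b \<le> 1/2" | "1/2 \<le> a" "b \<le> 3/4" | "3/4 \<le> a" "b \<le> 7/8" | "7/8 \<le> a"
      using ab(4)[of "1/2"] ab(4)[of "3/4"] ab(4)[of "7/8"] by auto
    then show "\<exists>(k::int) c. \<forall>x\<in>{a..b}. thompson_x1 x = 2 powi k * x + c"
    proof cases
      case 1
      then show ?thesis using ab
        by (intro exI[of _ "0"] exI[of _ "0"]) (auto simp: thompson_x1_def)
    next
      case 2
      then show ?thesis using ab
        by (intro exI[of _ "-1"] exI[of _ "1/4"]) (auto simp: thompson_x1_def)
    next
      case 3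
      then show ?thesis using ab
        by (intro exI[of _ "0"] exI[of _ "-1/8"]) (auto simp: thompson_x1_def)
    next
      case 4
      then show ?thesis using ab
        by (intro exI[of _ "1"] exI[of _ "-1"]) (auto simp: thompson_x1_def)
    qed
  qed (auto simp: dyadic_breakpoints)
qed (auto simp: thompson_x1_def strict_mono_on_def)

text \<open>Elements of the group and their inverses map null sets to null sets, so the choice of
  representative is irrelevant; so is the value of the derivative at the finitely many break points.\<close>

definition koopman :: "(real \<Rightarrow> real) \<Rightarrow> L2 \<Rightarrow> L2" where
  "koopman g f = abs_L2 (\<lambda>x. sqrt (deriv (inv\<^bsub>thompson_F\<^esub> g) x) * rep_L2 f ((inv\<^bsub>thompson_F\<^esub> g) x))"


section \<open>The Haar basis\<close>

definition haar_fun :: "nat \<Rightarrow> nat \<Rightarrow> real \<Rightarrow> real" where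
  "haar_fun i j x =
     (if (real j - 1) / 2 ^ i \<le> x \<and> x < (real j - 1) / 2 ^ i + 1 / 2 ^ (i + 1) then - (2 powr (real i / 2))
      else if (real j - 1) / 2 ^ i + 1 / 2 ^ (i + 1) \<le> x \<and> x \<le> real j / 2 ^ i then 2 powr (real i / 2)
      else 0)"

definition haar :: "nat \<Rightarrow> nat \<Rightarrow> L2" where
  "haar i j = abs_L2 (haar_fun i j)"

definition haar_const :: L2 where
  "haar_const = abs_L2 (\<lambda>_. 1)"

definition haar_basis :: "L2 set" where
  "haar_basis = insert haar_const {haar i j | i j. 1 \<le> j \<and> j \<le> 2 ^ i}"

text \<open>Only meaningful on the basis without the constant function.\<close>

definition haar_psi :: "L2 \<Rightarrow> real" where
  "haar_psi h = (THE d. \<exists>i j. 1 \<le> j \<and> j \<le> 2 ^ i \<and> h = haar i j \<and>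
                   d = (real j - 1) / 2 ^ i + 1 / 2 ^ (i + 1))"

definition haar_psi_inv :: "real \<Rightarrow> L2" where
  "haar_psi_inv = inv_into (haar_basis - {haar_const}) haar_psi"

lemma haar_fun_measurable: "haar_fun i j \<in> borel_measurable unit_measure"
proof -
  have "haar_fun i j \<in> borel_measurable borel"
    unfolding haar_fun_def by measurable
  then show ?thesis
    by (intro measurable_restrict_space1 measurable_completion) simp
qed

lemma square_integrable_haar: "square_integrable (haar_fun i j)"
  by (rule square_integrable_bounded[OF haar_fun_measurable, of _ _ "2 powr (real i / 2)"])
    (auto simp: haar_fun_def)

lemma square_integrable_one: "square_integrable (\<lambda>_. 1)"
  by (rule square_integrable_bounded[of _ 1]) auto

lemma AE_unit_ex:
  assumes ae: "AE x in unit_measure. P x" and ab: "0 \<le> a" "a < b" "b \<le> 1"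
  shows "\<exists>x\<in>{a<..<b}. P x"
proof (rule ccontr)
  assume n: "\<not> (\<exists>x\<in>{a<..<b}. P x)"
  have "AE x in lebesgue. x \<in> {0..1} \<longrightarrow> P x"
    using ae by (simp add: AE_restrict_space_iff)
  then have "AE x in lebesgue. x \<notin> {a<..<b}"
    by (rule AE_mp, intro AE_I2) (use n ab in auto)
  then have "{a<..<b} \<in> null_sets lebesgue"
    by (subst AE_iff_null_sets) auto
  then show False using ab by (simp add: null_sets_def)
qed

lemma haar_inject:
  assumes "1 \<le> j" "j \<le> 2 ^ i" "1 \<le> l" "l \<le> 2 ^ k" "haar i j = haar k l"
  shows "i = k" "j = l"
proof -
  have ae: "AE x in unit_measure. haar_fun i j x = haar_fun k l x"
    using assms(5) by (simp add: haar_def abs_L2_eq_iff square_integrable_haar)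
  let ?m = "(real j - 1) / 2 ^ i + 1 / 2 ^ (i + 1)"
  have "0 \<le> ?m" using assms by simp
  moreover have "?m < real j / 2 ^ i" by (simp add: field_simps)
  moreover have "real j \<le> 2 ^ i" using assms(2) by (metis of_nat_le_iff of_nat_numeral of_nat_power)
  then have "real j / 2 ^ i \<le> 1" by simp
  ultimately obtain x where x: "?m < x" "x < real j / 2 ^ i" and eq: "haar_fun i j x = haar_fun k l x"
    using AE_unit_ex[OF ae, of ?m "real j / 2 ^ i"] by auto
  have "haar_fun i j x = 2 powr (real i / 2)" using x by (simp add: haar_fun_def)
  then have pos: "haar_fun k l x = 2 powr (real i / 2)" using eq by simp
  have ne: "- (2 powr (real k / 2)) \<noteq> 2 powr (real i / 2)"
    by (smt (verit) powr_gt_zero)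
  have "2 powr (real i / 2) > 0" by simp
  then have in_k: "(real l - 1) / 2 ^ k + 1 / 2 ^ (k + 1) \<le> x" "x \<le> real l / 2 ^ k"
    and "2 powr (real i / 2) = 2 powr (real k / 2)"
    using pos ne by (auto simp: haar_fun_def split: if_splits)
  then show "i = k" by (simp add: powr_inj)
  have "(real j - 1) / 2 ^ i < x"
    using x(1) by (rule less_trans[rotated]) simp
  moreover have "(real l - 1) / 2 ^ i < x"
    using in_k(1) unfolding \<open>i = k\<close> by (rule less_le_trans[rotated]) simp
  ultimately have "real j - 1 < 2 ^ i * x" "2 ^ i * x < real j" "real l - 1 < 2 ^ i * x" "2 ^ i * x \<le> real l"
    using x(2) in_k(2) \<open>i = k\<close> by (auto simp: field_simps)
  then show "j = l" by linarith
qed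

lemma haar_neq_const:
  assumes "1 \<le> j" "j \<le> 2 ^ i"
  shows "haar i j \<noteq> haar_const"
proof
  assume "haar i j = haar_const"
  then have ae: "AE x in unit_measure. haar_fun i j x = 1"
    by (simp add: haar_def haar_const_def abs_L2_eq_iff square_integrable_haar square_integrable_one)
  let ?a = "(real j - 1) / 2 ^ i" and ?m = "(real j - 1) / 2 ^ i + 1 / 2 ^ (i + 1)"
  have "real j \<le> 2 ^ i" using assms(2) by (metis of_nat_le_iff of_nat_numeral of_nat_power)
  then have "real j / 2 ^ i \<le> 1" by simp
  moreover have "?m < real j / 2 ^ i" by (simp add: field_simps)
  ultimately have "?m \<le> 1" by linarith
  moreover have "0 \<le> ?a" using assms by simp
  ultimately obtain x where "?a < x" "x < ?m" "haar_fun i j x = 1"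
    using AE_unit_ex[OF ae, of ?a ?m] by auto
  moreover have "2 powr (real i / 2) > 0" by simp
  ultimately show False by (simp add: haar_fun_def)
qed

lemma haar_psi_haar:
  assumes "1 \<le> j" "j \<le> 2 ^ i"
  shows "haar_psi (haar i j) = (real j - 1) / 2 ^ i + 1 / 2 ^ (i + 1)"
  unfolding haar_psi_def
  by (rule the_equality) (use assms haar_inject[OF assms] in blast)+

lemma haar_midpoint_inject:
  assumes "1 \<le> j" "1 \<le> l"
    "(real j - 1) / 2 ^ i + 1 / 2 ^ (i + 1) = (real l - 1) / 2 ^ k + 1 / 2 ^ (k + 1)"
  shows "i = k \<and> j = l"
proof -
  have eq: "(2 * real j - 1) * 2 ^ k = (2 * real l - 1) * 2 ^ i"
  proof -
    have mid: "(real p - 1) / 2 ^ n + 1 / 2 ^ (n + 1) = (2 * real p - 1) / (2 * 2 ^ n)" for p n :: nat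
      by (simp add: field_simps)
    show ?thesis using assms(3) unfolding mid by (simp add: frac_eq_eq)
  qed
  have "real_of_int ((2 * int j - 1) * 2 ^ k) = real_of_int ((2 * int l - 1) * 2 ^ i)"
    using eq by simp
  then have eqi: "(2 * int j - 1) * 2 ^ k = (2 * int l - 1) * 2 ^ i"
    by (simp only: of_int_eq_iff)
  have False if "a < b" "(2 * p - 1) * 2 ^ b = (2 * q - 1) * 2 ^ a" for p q :: int and a b :: nat
  proof -
    obtain d where "b = a + Suc d" using \<open>a < b\<close> less_iff_Suc_add by auto
    then have "((2 * p - 1) * 2 ^ Suc d) * 2 ^ a = (2 * q - 1) * 2 ^ a"
      using that(2) by (simp add: power_add mult_ac)
    then have "(2 * p - 1) * 2 ^ Suc d = 2 * q - 1" by simp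
    then have "even (2 * q - 1)" by (metis dvd_mult dvd_triv_left power_Suc)
    then show False by simp
  qed
  then have "i = k" using eqi by (metis linorder_neqE_nat)
  then show ?thesis using eqi by simp
qed

lemma bij_betw_haar_psi:
  "bij_betw haar_psi (haar_basis - {haar_const}) (dyadics \<inter> {0<..<1})"
proof -
  have B: "haar_basis - {haar_const} = {haar i j | i j. 1 \<le> j \<and> j \<le> 2 ^ i}"
    using haar_neq_const by (auto simp: haar_basis_def)
  have surj: "m < 2 ^ k \<Longrightarrow> 0 < m \<Longrightarrow> \<exists>i j. 1 \<le> j \<and> j \<le> 2 ^ i \<and>
      real m / 2 ^ k = (real j - 1) / 2 ^ i + 1 / 2 ^ (i + 1)" for m k :: nat
  proof (induction k arbitrary: m)
    case 0 then show ?case by simp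
  next
    case (Suc k)
    show ?case
    proof (cases "even m")
      case True
      then obtain n where "m = 2 * n" by blast
      then show ?thesis using Suc by auto
    next
      case False
      then obtain n where m: "m = 2 * n + 1" by (blast elim: oddE)
      have "real m / 2 ^ Suc k = (real (Suc n) - 1) / 2 ^ k + 1 / 2 ^ (k + 1)"
        by (simp add: m field_simps)
      moreover have "Suc n \<le> 2 ^ k" using Suc.prems m by simp
      ultimately show ?thesis by (metis le_add1 plus_1_eq_Suc)
    qed
  qed
  have "inj_on haar_psi (haar_basis - {haar_const})"
    unfolding B
  proof (rule inj_onI)
    fix u v assume "u \<in> {haar i j | i j. 1 \<le> j \<and> j \<le> 2 ^ i}" "v \<in> {haar i j | i j. 1 \<le> j \<and> j \<le> 2 ^ i}"
      and eq: "haar_psi u = haar_psi v"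
    then obtain i j k l where u: "u = haar i j" "1 \<le> j" "j \<le> 2 ^ i"
      and v: "v = haar k l" "1 \<le> l" "l \<le> 2 ^ k" by blast
    have "i = k \<and> j = l"
      using eq unfolding u(1) v(1) haar_psi_haar[OF u(2,3)] haar_psi_haar[OF v(2,3)]
      by (rule haar_midpoint_inject[OF u(2) v(2)])
    then show "u = v" using u v by simp
  qed
  moreover have "haar_psi h \<in> dyadics \<inter> {0<..<1}" if h: "h \<in> haar_basis - {haar_const}" for h
  proof -
    obtain i j where ij: "h = haar i j" "1 \<le> j" "j \<le> 2 ^ i" using h unfolding B by blast
    have "real j \<le> 2 ^ i" using ij(3) by (metis of_nat_le_iff of_nat_numeral of_nat_power)
    moreover have "real (2 * j - 1) = 2 * real j - 1" "real j \<ge> 1" using ij by (auto simp: of_nat_diff)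
    moreover have "(2::real) ^ (i + 1) = 2 * 2 ^ i" by simp
    ultimately have "0 < real (2 * j - 1)" "real (2 * j - 1) < 2 ^ (i + 1)" by linarith+
    then have "0 < real (2 * j - 1) / 2 ^ (i + 1)" "real (2 * j - 1) / 2 ^ (i + 1) < 1"
      by (simp_all only: zero_less_divide_iff divide_less_eq_1) auto
    moreover have p: "haar_psi h = real (2 * j - 1) / 2 ^ (i + 1)"
      using ij by (simp add: haar_psi_haar field_simps of_nat_diff)
    moreover have "haar_psi h \<in> dyadics" unfolding p dyadics_def by blast
    ultimately show ?thesis by (simp only: p Int_iff greaterThanLessThan_iff)
  qed
  moreover have "d \<in> haar_psi ` (haar_basis - {haar_const})" if d: "d \<in> dyadics \<inter> {0<..<1}" for d
  proof -
    obtain m k where mk: "d = real m / 2 ^ k" using d by (auto simp: dyadics_def)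
    have "0 < real m / 2 ^ k" "real m / 2 ^ k < 1" using d unfolding mk by auto
    then have "0 < m" "real m < 2 ^ k" by (auto simp: zero_less_divide_iff)
    then have "m < 2 ^ k" by (metis of_nat_less_iff of_nat_numeral of_nat_power)
    with surj[of m k] \<open>0 < m\<close> obtain i j where "1 \<le> j" "j \<le> 2 ^ i"
      "d = (real j - 1) / 2 ^ i + 1 / 2 ^ (i + 1)" using mk by auto
    then have "d = haar_psi (haar i j)" "haar i j \<in> haar_basis - {haar_const}"
      unfolding B by (auto simp: haar_psi_haar)
    then show ?thesis by blast
  qed
  ultimately show ?thesis by (auto simp: bij_betw_def)
qed

end

theory Submission
  imports Defs
begin

text \<open>
  If \<open>g\<close> is affine on the support of a Haar function, then the normalising factor of the Koopman
  operator is exactly the one that turns this function into the Haar function of the image interval,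
  whose midpoint is the image of the midpoint; by orthonormality there is a single arrow. The only
  Haar functions whose support contains a break point of the generator in its interior, together with
  the constant function, are step functions on the intervals of linearity. Their images are step
  functions on the image intervals, and expanding them in the Haar basis leaves only the listed
  vertices, with coefficients that do not vanish because of the bounds \<open>7/5 < sqrt 2 < 3/2\<close>.
\<close>

section \<open>Almost everywhere equality and the choice of representatives\<close>

text \<open>Finite sets are null, so identities between step functions need checking only away from
  the endpoints and break points, where neither half-open conventions nor the value of
  \<open>deriv\<close> interfere.\<close>

lemma AE_unit_measure_if_finite:
  assumes "finite S" "\<And>x. x \<in> {0<..<1} - S \<Longrightarrow> P x"
  shows "AE x in unit_measure. P x"
proof -
  have "negligible (insert 0 (insert 1 S))"
    using assms(1) by (intro negligible_finite) simp
  moreover have "{x. \<not> (x \<in> {0..1} \<longrightarrow> P x)} \<subseteq> insert 0 (insert 1 S)"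
    using assms(2) by force
  ultimately have "AE x in lebesgue. x \<in> {0..1} \<longrightarrow> P x"
    unfolding eventually_ae_filter_negligible by blast
  then show ?thesis by (simp add: AE_restrict_space_iff)
qed

text \<open>Completeness of Lebesgue measure carries measurability across a null set. This serves
  the function inside \<open>koopman\<close>, whose measurability is not visible from its
  formula.\<close>

lemma square_integrable_cong_AE:
  assumes F: "square_integrable F" and ae: "AE x in unit_measure. f x = F x"
  shows "square_integrable f"
proof -
  \<comment> \<open>Extension by zero leads from the unit interval to the whole line, where changes
    on a null set preserve Lebesgue measurability.\<close>
  have F0: "(\<lambda>x. if x \<in> {0..1} then F x else 0) \<in> borel_measurable lebesgue"
    using square_integrable_measurable[OF F] by (subst borel_measurable_if) auto
  have "AE x in lebesgue. x \<in> {0..1} \<longrightarrow> f x = F x"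
    using ae by (simp add: AE_restrict_space_iff)
  then have "AE x in lebesgue. (if x \<in> {0..1} then F x else 0) = (if x \<in> {0..1} then f x else 0)"
    by (rule AE_mp) (intro AE_I2, simp)
  from borel_measurable_AE[OF F0 this] have f: "f \<in> borel_measurable unit_measure"
    by (subst (asm) borel_measurable_if) auto
  have "integrable unit_measure (\<lambda>x. (f x)\<^sup>2) \<longleftrightarrow> integrable unit_measure (\<lambda>x. (F x)\<^sup>2)"
    using f square_integrable_measurable[OF F] ae
    by (intro integrable_cong_AE) (auto elim!: AE_mp)
  with f F show ?thesis by (simp add: square_integrable_def)
qed

text \<open>Every interior point off the finite set has a neighbourhood on which \<open>g\<close> is
  affine.\<close>

lemma thompson_differentiable:
  assumes "g \<in> carrier thompson_F"
  obtains P where "finite P" "\<And>x. x \<in> {0<..<1} - P \<Longrightarrow> g differentiable at x"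
proof -
  obtain P where P: "finite P"
    and lin: "\<And>a b. 0 \<le> a \<Longrightarrow> a < b \<Longrightarrow> b \<le> 1 \<Longrightarrow> {a<..<b} \<inter> P = {} \<Longrightarrow>
           (\<exists>(k::int) c. \<forall>x\<in>{a..b}. g x = 2 powi k * x + c)"
    using dyadic_piecewise_linearE[OF thompson_carrierD(4)[OF assms]] by metis
  have "g differentiable at x" if x: "x \<in> {0<..<1} - P" for x
  proof -
    have "open ({0<..<1} - P)" using P by (intro open_Diff finite_imp_closed) auto
    with x obtain e where e: "e > 0" "cball x e \<subseteq> {0<..<1} - P"
      unfolding open_contains_cball by blast
    have sub: "{x-e..x+e} \<subseteq> {0<..<1} - P" using e(2) by (simp add: cball_eq_atLeastAtMost)
    have "x - e \<in> {x-e..x+e}" "x + e \<in> {x-e..x+e}" using e(1) by auto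
    with sub have "0 \<le> x - e" "x + e \<le> 1" by fastforce+
    moreover have "{x-e<..<x+e} \<inter> P = {}"
      using sub greaterThanLessThan_subseteq_atLeastAtMost_iff[of "x-e" "x+e" "x-e" "x+e"] by blast
    ultimately obtain k :: int and c where kc: "\<forall>y\<in>{x-e..x+e}. g y = 2 powi k * y + c"
      using lin[of "x - e" "x + e"] e(1) by auto
    have "((\<lambda>y. 2 powi k * y + c) has_field_derivative 2 powi k) (at x)"
      by (auto intro!: derivative_eq_intros)
    then have "(g has_field_derivative 2 powi k) (at x)"
      by (rule has_field_derivative_transform_within_open[of _ _ _ "{x-e<..<x+e}"])
        (use e kc in auto)
    then show ?thesis using real_differentiable_def by blast
  qed
  with P that show thesis by blast
qed

lemma thompson_inv:
  assumes "g \<in> carrier thompson_F" "x \<in> {0..1}"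
  shows "(inv\<^bsub>thompson_F\<^esub> g) x \<in> {0..1}" "g ((inv\<^bsub>thompson_F\<^esub> g) x) = x"
  using inv_into_into[of x g "{0..1}"] f_inv_into_f[of x g "{0..1}"] assms
  by (simp_all add: inv_thompson_F thompson_carrierD(5))

lemma thompson_inv_eq:
  assumes "g \<in> carrier thompson_F" "y \<in> {0..1}"
  shows "(inv\<^bsub>thompson_F\<^esub> g) (g y) = y"
proof -
  have "inj_on g {0..1}"
    using thompson_carrierD(1)[OF assms(1)] by (auto simp: Bij_def bij_betw_def)
  moreover have "g y \<in> {0..1}"
    using thompson_carrierD(5)[OF assms(1)] assms(2) by blast
  ultimately show ?thesis using assms(2) by (simp add: inv_thompson_F[OF assms(1)])
qed

text \<open>The exceptional set of the composite lies in the image under \<open>g\<close> of the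
  exceptional set of \<open>Q\<close>. A differentiable map of the line sends null sets to null
  sets, and the finitely many remaining points have a finite image.\<close>

lemma AE_compose_thompson_inv:
  assumes g: "g \<in> carrier thompson_F" and ae: "AE x in unit_measure. Q x"
  shows "AE x in unit_measure. Q ((inv\<^bsub>thompson_F\<^esub> g) x)"
proof -
  have "AE x in lebesgue. x \<in> {0..1} \<longrightarrow> Q x"
    using ae by (simp add: AE_restrict_space_iff)
  then obtain N where N: "negligible N" "{x. \<not> (x \<in> {0..1} \<longrightarrow> Q x)} \<subseteq> N"
    unfolding eventually_ae_filter_negligible by blast
  obtain P where P: "finite P" "\<And>x. x \<in> {0<..<1} - P \<Longrightarrow> g differentiable at x"
    using thompson_differentiable[OF g] by blast
  \<comment> \<open>The endpoints join the break points because differentiability is known only at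
    interior points.\<close>
  define R where "R = insert 0 (insert 1 P)"
  have "negligible (g ` (N \<inter> {0..1} - R))"
  proof (rule negligible_differentiable_image_negligible)
    show "negligible (N \<inter> {0..1} - R)"
      by (rule negligible_subset[OF N(1)]) auto
    show "g differentiable_on N \<inter> {0..1} - R"
      unfolding differentiable_on_def
    proof
      fix x assume "x \<in> N \<inter> {0..1} - R"
      then have "x \<in> {0<..<1} - P" by (simp add: R_def less_le)
      then show "g differentiable at x within N \<inter> {0..1} - R"
        using P(2) differentiable_at_withinI by blast
    qed
  qed simp
  moreover have "negligible (g ` R)"
    using P(1) by (intro negligible_finite) (simp add: R_def)
  ultimately have "negligible (g ` (N \<inter> {0..1} - R) \<union> g ` R)" by (rule negligible_Un)
  moreover have "{x. \<not> (x \<in> {0..1} \<longrightarrow> Q ((inv\<^bsub>thompson_F\<^esub> g) x))} \<subseteq> g ` (N \<inter> {0..1} - R) \<union> g ` R"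
  proof
    fix x assume x: "x \<in> {x. \<not> (x \<in> {0..1} \<longrightarrow> Q ((inv\<^bsub>thompson_F\<^esub> g) x))}"
    let ?y = "(inv\<^bsub>thompson_F\<^esub> g) x"
    have "?y \<in> {0..1}" "x = g ?y" "?y \<in> N" using x thompson_inv[OF g, of x] N(2) by auto
    then show "x \<in> g ` (N \<inter> {0..1} - R) \<union> g ` R" by blast
  qed
  ultimately have "AE x in lebesgue. x \<in> {0..1} \<longrightarrow> Q ((inv\<^bsub>thompson_F\<^esub> g) x)"
    unfolding eventually_ae_filter_negligible by blast
  then show ?thesis by (simp add: AE_restrict_space_iff)
qed

text \<open>\<open>rep_L2\<close> returns an unspecified representative, but it agrees with
  \<open>f\<close> off a null set, and this survives composition with the inverse of
  \<open>g\<close>. Images can therefore be computed from explicit functions.\<close>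

lemma koopman_abs_L2:
  assumes g: "g \<in> carrier thompson_F" and f: "square_integrable f" and F: "square_integrable F"
    and ae: "AE x in unit_measure. sqrt (deriv (inv\<^bsub>thompson_F\<^esub> g) x) * f ((inv\<^bsub>thompson_F\<^esub> g) x) = F x"
  shows "koopman g (abs_L2 f) = abs_L2 F"
proof -
  let ?G = "\<lambda>x. sqrt (deriv (inv\<^bsub>thompson_F\<^esub> g) x) * rep_L2 (abs_L2 f) ((inv\<^bsub>thompson_F\<^esub> g) x)"
  have eq: "AE x in unit_measure. ?G x = F x"
    using AE_compose_thompson_inv[OF g rep_abs_L2[OF f]] ae by eventually_elim simp
  then have "square_integrable ?G" by (rule square_integrable_cong_AE[OF F])
  with F eq show ?thesis by (simp add: koopman_def abs_L2_eq_iff)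
qed

text \<open>On the open image of a piece of linearity the inverse is the inverse affine map, and
  openness determines the derivative. The last two conclusions place the preimage inside the piece,
  where the value of a step function is known.\<close>

lemma thompson_inv_affine:
  assumes g: "g \<in> carrier thompson_F" and ab: "0 \<le> a" "b \<le> 1" and s: "s > 0"
    and aff: "\<And>y. a \<le> y \<Longrightarrow> y \<le> b \<Longrightarrow> g y = s * y + c"
    and x: "s * a + c < x" "x < s * b + c"
  shows "(inv\<^bsub>thompson_F\<^esub> g) x = (x - c) / s" "deriv (inv\<^bsub>thompson_F\<^esub> g) x = 1 / s"
    "a < (x - c) / s" "(x - c) / s < b"
proof -
  \<comment> \<open>Shown for every \<open>z\<close> in the image interval, since the derivative at
    \<open>x\<close> depends on a neighbourhood.\<close>
  have inv: "(inv\<^bsub>thompson_F\<^esub> g) z = (z - c) / s" if "s * a + c < z" "z < s * b + c" for z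
  proof -
    have "a < (z - c) / s" "(z - c) / s < b" using that s by (simp_all add: field_simps)
    moreover from this have "g ((z - c) / s) = z" using s by (simp add: aff)
    ultimately show ?thesis using thompson_inv_eq[OF g, of "(z - c) / s"] ab by simp
  qed
  show "(inv\<^bsub>thompson_F\<^esub> g) x = (x - c) / s" by (rule inv[OF x])
  show "a < (x - c) / s" "(x - c) / s < b" using x s by (simp_all add: field_simps)
  have "((\<lambda>z. (z - c) / s) has_field_derivative 1 / s) (at x)"
    using s by (auto intro!: derivative_eq_intros)
  then have "(inv\<^bsub>thompson_F\<^esub> g has_field_derivative 1 / s) (at x)"
    by (rule has_field_derivative_transform_within_open[of _ _ _ "{s * a + c<..<s * b + c}"])
      (use x inv in auto)
  then show "deriv (inv\<^bsub>thompson_F\<^esub> g) x = 1 / s" by (rule DERIV_imp_deriv)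
qed

section \<open>Orthonormality of the Haar system\<close>

lemma unit_measure_Icc:
  fixes a b :: real
  assumes "0 \<le> a" "a \<le> b" "b \<le> 1"
  shows "measure unit_measure {a..b} = b - a"
    and "integrable unit_measure (indicator {a..b} :: real \<Rightarrow> real)"
proof -
  have sub: "{a..b} \<subseteq> {0..1}" using assms by auto
  then have s: "{a..b} \<in> sets unit_measure" by (simp add: sets_restrict_space_iff)
  show "measure unit_measure {a..b} = b - a"
    using assms sub by (simp add: measure_restrict_space)
  show "integrable unit_measure (indicator {a..b} :: real \<Rightarrow> real)"
    using s sub assms by (intro integrable_real_indicator) (simp_all add: emeasure_restrict_space)
qed

lemma haar_interval:
  assumes "1 \<le> j" "j \<le> 2 ^ i"
  shows "0 \<le> (real j - 1) / 2 ^ i"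
    and "(real j - 1) / 2 ^ i + 1 / 2 ^ (i + 1) = (real j - 1 / 2) / 2 ^ i"
    and "(real j - 1) / 2 ^ i < (real j - 1 / 2) / 2 ^ i"
    and "(real j - 1 / 2) / 2 ^ i < real j / 2 ^ i" and "real j / 2 ^ i \<le> 1"
proof -
  have "real j \<le> 2 ^ i" using assms(2) by (metis of_nat_le_iff of_nat_numeral of_nat_power)
  then show "real j / 2 ^ i \<le> 1" by simp
  show "0 \<le> (real j - 1) / 2 ^ i" using assms(1) by simp
qed (simp_all add: field_simps)

text \<open>The two halves of the support have equal length and carry opposite values.\<close>

lemma integral_haar_fun:
  assumes "1 \<le> j" "j \<le> 2 ^ i"
  shows "integral\<^sup>L unit_measure (haar_fun i j) = 0"
proof -
  define a m b where "a = (real j - 1) / 2 ^ i" and "m = (real j - 1 / 2) / 2 ^ i"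
    and "b = real j / 2 ^ i"
  note D = haar_interval[OF assms, folded a_def m_def b_def]
  have ind: "integrable unit_measure (indicator {m..b} :: real \<Rightarrow> real)"
    "integrable unit_measure (indicator {a..m} :: real \<Rightarrow> real)"
    using D by (auto intro!: unit_measure_Icc(2))
  have "integral\<^sup>L unit_measure (haar_fun i j) = integral\<^sup>L unit_measure
     (\<lambda>x. 2 powr (real i / 2) * indicator {m..b} x - 2 powr (real i / 2) * indicator {a..m} x)"
  proof (rule integral_cong_AE)
    \<comment> \<open>The closed intervals overlap at \<open>m\<close>, which is one of the
      exceptional points.\<close>
    show "AE x in unit_measure. haar_fun i j x =
       2 powr (real i / 2) * indicator {m..b} x - 2 powr (real i / 2) * indicator {a..m} x"
      by (rule AE_unit_measure_if_finite[of "{a, m, b}"])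
        (use D in \<open>auto simp: haar_fun_def indicator_def a_def[symmetric] b_def[symmetric]\<close>)
  qed (use ind haar_fun_measurable in auto)
  also have "\<dots> = 2 powr (real i / 2) * (b - m) - 2 powr (real i / 2) * (m - a)"
  proof -
    have "{m..b} \<inter> {0..1} = {m..b}" "{a..m} \<inter> {0..1} = {a..m}" using D by auto
    then show ?thesis
      using D ind by (simp add: unit_measure_Icc space_restrict_space del: Int_atLeastAtMost)
  qed
  also have "b - m = m - a" by (simp add: a_def m_def b_def field_simps)
  finally show ?thesis by simp
qed

text \<open>The square equals \<open>2 ^ i\<close> on an interval of length
  \<open>1 / 2 ^ i\<close>.\<close>

lemma integral_haar_fun_square:
  assumes "1 \<le> j" "j \<le> 2 ^ i"
  shows "integral\<^sup>L unit_measure (\<lambda>x. haar_fun i j x * haar_fun i j x) = 1"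
proof -
  define a m b where "a = (real j - 1) / 2 ^ i" and "m = (real j - 1 / 2) / 2 ^ i"
    and "b = real j / 2 ^ i"
  note D = haar_interval[OF assms, folded a_def m_def b_def]
  have pow: "2 powr (real i / 2) * 2 powr (real i / 2) = (2::real) ^ i"
    by (simp flip: powr_add add: powr_realpow)
  have ind: "integrable unit_measure (indicator {a..b} :: real \<Rightarrow> real)"
    using D by (intro unit_measure_Icc(2)) linarith+
  have "integral\<^sup>L unit_measure (\<lambda>x. haar_fun i j x * haar_fun i j x) =
      integral\<^sup>L unit_measure (\<lambda>x. 2 ^ i * indicator {a..b} x)"
  proof (rule integral_cong_AE)
    show "AE x in unit_measure. haar_fun i j x * haar_fun i j x = 2 ^ i * indicator {a..b} x"
      by (rule AE_unit_measure_if_finite[of "{a, m, b}"])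
        (use D pow in \<open>auto simp: haar_fun_def indicator_def a_def[symmetric] b_def[symmetric]\<close>)
  qed (use ind haar_fun_measurable in auto)
  also have "\<dots> = 2 ^ i * (b - a)"
  proof -
    have "{a..b} \<inter> {0..1} = {a..b}" using D by auto
    then show ?thesis
      using D ind by (simp add: unit_measure_Icc space_restrict_space del: Int_atLeastAtMost)
  qed
  also have "\<dots> = 1" by (simp add: a_def b_def field_simps)
  finally show ?thesis .
qed

text \<open>The coarser of two different Haar functions is constant on the support of the finer one, because
  its break points lie on the grid of the finer one.\<close>

lemma haar_fun_mult_AE:
  assumes "1 \<le> l" "l \<le> 2 ^ k" "i \<le> k" "i = k \<Longrightarrow> j \<noteq> l"
  obtains c where "AE x in unit_measure. haar_fun i j x * haar_fun k l x = c * haar_fun k l x"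
proof -
  define u v where "u = (real l - 1) / 2 ^ k" and "v = real l / 2 ^ k"
  have "\<exists>c. \<forall>x\<in>{u<..<v}. haar_fun i j x = c"
  proof (cases "i = k")
    case True
    have "haar_fun i j x = 0" if "x \<in> {u<..<v}" for x
    proof (rule ccontr)
      assume "haar_fun i j x \<noteq> 0"
      then have "(real j - 1) / 2 ^ i \<le> x" "x \<le> (real j - 1) / 2 ^ i + 1 / 2 ^ (i + 1) \<or> x \<le> real j / 2 ^ i"
        by (auto simp: haar_fun_def split: if_splits) (smt (verit) divide_nonneg_nonneg zero_le_power)
      moreover have "(real j - 1) / 2 ^ i + 1 / 2 ^ (i + 1) \<le> real j / 2 ^ i" by (simp add: field_simps)
      ultimately have "(real j - 1) / 2 ^ k \<le> x" "x \<le> real j / 2 ^ k"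
        using True by auto
      \<comment> \<open>Scaling by \<open>2 ^ k\<close> puts the point in the closed unit cell of
        \<open>j\<close> and in the open unit cell of \<open>l\<close>, which forces
        \<open>j = l\<close>.\<close>
      then have "real j - 1 \<le> 2 ^ k * x" "2 ^ k * x \<le> real j"
        by (simp_all add: field_simps)
      moreover have "real l - 1 < 2 ^ k * x" "2 ^ k * x < real l"
        using that by (auto simp: u_def v_def field_simps)
      ultimately show False using assms(4) True by linarith
    qed
    then show ?thesis by blast
  next
    case False
    then obtain d where k: "k = Suc (i + d)" using assms(3) less_iff_Suc_add[of i k] by auto
    \<comment> \<open>Inside an open cell of the grid of mesh \<open>1 / 2 ^ k\<close>, comparison
      with a grid point has the same outcome at every point.\<close>
    have grid: "of_int N / 2 ^ k \<le> x \<longleftrightarrow> N < int l" "x < of_int N / 2 ^ k \<longleftrightarrow> int l \<le> N"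
      "x \<le> of_int N / 2 ^ k \<longleftrightarrow> int l \<le> N" if "x \<in> {u<..<v}" for x :: real and N :: int
    proof -
      have x: "real l - 1 < 2 ^ k * x" "2 ^ k * x < real l"
        using that by (auto simp: u_def v_def field_simps)
      have "of_int N / 2 ^ k \<le> x \<longleftrightarrow> of_int N \<le> 2 ^ k * x" "x < of_int N / 2 ^ k \<longleftrightarrow> 2 ^ k * x < of_int N"
        "x \<le> of_int N / 2 ^ k \<longleftrightarrow> 2 ^ k * x \<le> of_int N"
        by (simp_all add: field_simps)
      then show "of_int N / 2 ^ k \<le> x \<longleftrightarrow> N < int l" "x < of_int N / 2 ^ k \<longleftrightarrow> int l \<le> N"
        "x \<le> of_int N / 2 ^ k \<longleftrightarrow> int l \<le> N"
        using x by linarith+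
    qed
    \<comment> \<open>Numerators over \<open>2 ^ k\<close> of the left end, midpoint and right end
      of the coarser interval. The midpoint is a grid point because \<open>k\<close> exceeds
      \<open>i\<close> by at least one.\<close>
    define p q r where "p = 2 * (int j - 1) * 2 ^ d" and "q = (2 * int j - 1) * 2 ^ d"
      and "r = 2 * int j * 2 ^ d"
    have "(real j - 1) / 2 ^ i = of_int p / 2 ^ k" "real j / 2 ^ i = of_int r / 2 ^ k"
      "(real j - 1) / 2 ^ i + 1 / 2 ^ (i + 1) = of_int q / 2 ^ k"
      by (simp_all add: p_def q_def r_def k power_add field_simps)
    then have "haar_fun i j x = (if p < int l \<and> int l \<le> q then - (2 powr (real i / 2))
        else if q < int l \<and> int l \<le> r then 2 powr (real i / 2) else 0)"
      if "x \<in> {u<..<v}" for x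
      unfolding haar_fun_def by (simp only: grid[OF that])
    then show ?thesis by blast
  qed
  then obtain c where c: "\<And>x. x \<in> {u<..<v} \<Longrightarrow> haar_fun i j x = c" by blast
  define z where "z = u + 1 / 2 ^ (k + 1)"
  have mid: "u < z" "z < v" by (simp_all add: z_def u_def v_def field_simps)
  have "haar_fun i j x * haar_fun k l x = c * haar_fun k l x" if "x \<notin> {u, v}" for x
  proof (cases "x \<in> {u<..<v}")
    case False
    then have "haar_fun k l x = 0"
      using that mid unfolding haar_fun_def u_def[symmetric] v_def[symmetric] z_def[symmetric] by auto
    then show ?thesis by simp
  qed (simp add: c)
  then show thesis
    by (intro that[of c] AE_unit_measure_if_finite[of "{u, v}"]) auto
qed

lemma inner_haar_const_haar:
  assumes "1 \<le> j" "j \<le> 2 ^ i"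
  shows "inner haar_const (haar i j) = 0"
  using integral_haar_fun[OF assms]
  by (simp add: haar_const_def haar_def inner_abs_L2 square_integrable_one square_integrable_haar)

text \<open>The product of two different functions is almost everywhere a multiple of the finer one,
  whose integral is zero. Symmetry reduces to the case where the finer one comes second.\<close>

lemma inner_haar_haar:
  assumes "1 \<le> j" "j \<le> 2 ^ i" "1 \<le> l" "l \<le> 2 ^ k"
  shows "inner (haar i j) (haar k l) = (if i = k \<and> j = l then 1 else 0)"
proof -
  have zero: "inner (haar i j) (haar k l) = 0"
    if "1 \<le> l" "l \<le> 2 ^ k" "i \<le> k" "i = k \<Longrightarrow> j \<noteq> l" for i j k l
  proof -
    obtain c where c: "AE x in unit_measure. haar_fun i j x * haar_fun k l x = c * haar_fun k l x"
      using haar_fun_mult_AE[OF \<open>1 \<le> l\<close> \<open>l \<le> 2 ^ k\<close> \<open>i \<le> k\<close> \<open>i = k \<Longrightarrow> j \<noteq> l\<close>] by blast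
    have [measurable]: "haar_fun i j \<in> borel_measurable unit_measure" for i j
      by (rule haar_fun_measurable)
    have "integral\<^sup>L unit_measure (\<lambda>x. haar_fun i j x * haar_fun k l x) =
        integral\<^sup>L unit_measure (\<lambda>x. c * haar_fun k l x)"
      by (rule integral_cong_AE[OF _ _ c]) measurable
    then show ?thesis
      using integral_haar_fun[OF \<open>1 \<le> l\<close> \<open>l \<le> 2 ^ k\<close>]
      by (simp add: haar_def inner_abs_L2 square_integrable_haar)
  qed
  show ?thesis
  proof (cases "i = k \<and> j = l")
    case True
    then show ?thesis using integral_haar_fun_square[OF assms(1,2)]
      by (simp add: haar_def inner_abs_L2 square_integrable_haar)
  next
    case False
    have "inner (haar i j) (haar k l) = 0"
    proof (cases "i \<le> k")
      case True
      then show ?thesis using False by (intro zero[OF assms(3,4)]) auto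
    next
      case f: False
      then have "inner (haar k l) (haar i j) = 0" by (intro zero[OF assms(1,2)]) auto
      then show ?thesis by (simp only: inner_commute)
    qed
    with False show ?thesis by simp
  qed
qed

lemma haar_eq_iff:
  assumes "1 \<le> j" "j \<le> 2 ^ i" "1 \<le> l" "l \<le> 2 ^ k"
  shows "haar i j = haar k l \<longleftrightarrow> i = k \<and> j = l"
  using haar_inject[OF assms] by blast

text \<open>In this form, inner products with basis vectors read off the coefficients of an image,
  and hence the arrows.\<close>

lemma inner_haar_basis:
  assumes "v \<in> haar_basis" "w \<in> haar_basis"
  shows "inner v w = (if v = w then 1 else 0)"
proof -
  have one: "inner haar_const haar_const = 1"
    by (simp add: haar_const_def inner_abs_L2 square_integrable_one
        measure_restrict_space space_restrict_space)
  have mixed: "inner (haar i j) haar_const = 0" if "1 \<le> j" "j \<le> 2 ^ i" for i j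
    using inner_haar_const_haar[OF that] by (simp only: inner_commute)
  show ?thesis
    using assms by (auto simp: haar_basis_def one mixed inner_haar_const_haar inner_haar_haar
        haar_eq_iff haar_neq_const haar_neq_const[symmetric])
qed

section \<open>Haar functions supported on a piece of linearity\<close>

lemma haar_in_haar_basis: "1 \<le> j \<Longrightarrow> j \<le> 2 ^ i \<Longrightarrow> haar i j \<in> haar_basis"
  by (auto simp: haar_basis_def)

lemma haar_psi_inv_haar_psi:
  assumes "1 \<le> l" "l \<le> 2 ^ k"
  shows "haar_psi_inv (haar_psi (haar k l)) = haar k l"
  unfolding haar_psi_inv_def
  using assms bij_betw_haar_psi haar_in_haar_basis haar_neq_const
  by (intro inv_into_f_f) (auto simp: bij_betw_def)

text \<open>On the support of \<open>haar i j\<close> the map \<open>g\<close> is the increasing affine bijection onto the support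
  of \<open>haar k l\<close>.\<close>

lemma koopman_haar_affine:
  assumes g: "g \<in> carrier thompson_F" and ij: "1 \<le> j" "j \<le> 2 ^ i" and kl: "1 \<le> l" "l \<le> 2 ^ k"
    and aff: "\<And>y. (real j - 1) / 2 ^ i \<le> y \<Longrightarrow> y \<le> real j / 2 ^ i \<Longrightarrow>
      g y = (2 ^ i * y + real l - real j) / 2 ^ k"
  shows "koopman g (haar i j) = haar k l"
    and "haar_psi_inv (g (haar_psi (haar i j))) = haar k l"
proof -
  define a m b where "a = (real j - 1) / 2 ^ i" and "m = (real j - 1 / 2) / 2 ^ i"
    and "b = real j / 2 ^ i"
  define a' m' b' where "a' = (real l - 1) / 2 ^ k" and "m' = (real l - 1 / 2) / 2 ^ k"
    and "b' = real l / 2 ^ k"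
  note D = haar_interval[OF ij, folded a_def m_def b_def]
  note D' = haar_interval[OF kl, folded a'_def m'_def b'_def]
  \<comment> \<open>The slope \<open>s\<close> is the length of the target support divided by that
    of the source support.\<close>
  define s c where "s = (2::real) ^ i / 2 ^ k" and "c = (real l - real j) / 2 ^ k"
  have s: "s > 0" by (simp add: s_def)
  have aff': "g y = s * y + c" if "a \<le> y" "y \<le> b" for y
    using aff[of y] that
    by (simp add: a_def b_def s_def c_def add_divide_distrib diff_divide_distrib)
  have ends: "s * a + c = a'" "s * m + c = m'" "s * b + c = b'"
    by (simp_all add: s_def c_def a_def a'_def m_def m'_def b_def b'_def field_simps)
  \<comment> \<open>The Koopman factor turns the height at level \<open>i\<close> into the height at
    level \<open>k\<close>. Both sides are nonnegative, so it is enough to compare squares.\<close>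
  have root: "sqrt (1 / s) * 2 powr (real i / 2) = 2 powr (real k / 2)"
  proof -
    have "(sqrt (1 / s) * 2 powr (real i / 2))\<^sup>2 = (2 powr (real k / 2))\<^sup>2"
      using s by (simp add: power_mult_distrib powr_half_sqrt_powr powr_realpow s_def)
    then show ?thesis using s by (subst (asm) power2_eq_iff_nonneg) auto
  qed
  have "sqrt (deriv (inv\<^bsub>thompson_F\<^esub> g) x) * haar_fun i j ((inv\<^bsub>thompson_F\<^esub> g) x) = haar_fun k l x"
    if x: "x \<in> {0<..<1} - {a', m', b'}" for x
  proof (cases "a' < x \<and> x < b'")
    case True
    let ?y = "(x - c) / s"
    have y: "(inv\<^bsub>thompson_F\<^esub> g) x = ?y" "deriv (inv\<^bsub>thompson_F\<^esub> g) x = 1 / s" "a < ?y" "?y < b"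
      using thompson_inv_affine[OF g D(1) D(5) s aff', of x] True unfolding ends by auto
    have "?y < m \<longleftrightarrow> x < s * m + c" using s by (auto simp: field_simps)
    then have "?y < m \<longleftrightarrow> x < m'" by (simp only: ends)
    then have "haar_fun i j ?y = (if x < m' then - (2 powr (real i / 2)) else 2 powr (real i / 2))"
      "haar_fun k l x = (if x < m' then - (2 powr (real k / 2)) else 2 powr (real k / 2))"
      unfolding haar_fun_def D(2) D'(2) using y(3,4) True D D'
      unfolding a_def[symmetric] b_def[symmetric] a'_def[symmetric] b'_def[symmetric] by auto
    then show ?thesis using root by (simp add: y)
  next
    case False
    let ?y = "(inv\<^bsub>thompson_F\<^esub> g) x"
    have y: "g ?y = x" using thompson_inv[OF g, of x] x by auto
    \<comment> \<open>A preimage in the closed source interval would put \<open>x\<close> in the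
      closed target interval, whose interior and ends are excluded here.\<close>
    have "\<not> (a \<le> ?y \<and> ?y \<le> b)"
    proof
      assume *: "a \<le> ?y \<and> ?y \<le> b"
      then have "x = s * ?y + c" using aff'[of ?y] y by simp
      moreover have "s * a \<le> s * ?y" "s * ?y \<le> s * b" using * s by simp_all
      ultimately have "a' \<le> x" "x \<le> b'" using ends by linarith+
      then show False using False x by auto
    qed
    then have "haar_fun i j ?y = 0"
      unfolding haar_fun_def D(2) a_def[symmetric] b_def[symmetric] m_def[symmetric] using D(3,4) by auto
    moreover have "haar_fun k l x = 0"
      unfolding haar_fun_def D'(2) a'_def[symmetric] b'_def[symmetric] m'_def[symmetric]
      using D'(3,4) False x by auto
    ultimately show ?thesis by simp
  qed
  then show "koopman g (haar i j) = haar k l"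
    unfolding haar_def
    by (intro koopman_abs_L2 g square_integrable_haar AE_unit_measure_if_finite[of "{a', m', b'}"]) auto
  have "g (haar_psi (haar i j)) = haar_psi (haar k l)"
    using aff'[of m] D(3,4) ends(2)
      haar_psi_haar[OF ij, folded a_def, unfolded D(2)] haar_psi_haar[OF kl, folded a'_def, unfolded D'(2)]
    by simp
  then show "haar_psi_inv (g (haar_psi (haar i j))) = haar k l"
    by (simp add: haar_psi_inv_haar_psi[OF kl])
qed

section \<open>Images of step functions and the exceptional vertices\<close>

lemma scaleR_abs_L2: "square_integrable f \<Longrightarrow> a *\<^sub>R abs_L2 f = abs_L2 (\<lambda>x. a * f x)"
  by (simp add: scaleR_L2.abs_eq L2_rel_def)

lemma plus_abs_L2:
  "square_integrable f \<Longrightarrow> square_integrable g \<Longrightarrow> abs_L2 f + abs_L2 g = abs_L2 (\<lambda>x. f x + g x)"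
  by (simp add: plus_L2.abs_eq L2_rel_def)

text \<open>The factor \<open>1\<close> and the summand \<open>0\<close> are kept so that every
  piece has the shape \<open>s * y + c\<close> of \<open>thompson_inv_affine\<close>.\<close>

lemma thompson_x0_affine:
  "0 \<le> y \<Longrightarrow> y \<le> 1/2 \<Longrightarrow> thompson_x0 y = 1/2 * y + 0"
  "1/2 \<le> y \<Longrightarrow> y \<le> 3/4 \<Longrightarrow> thompson_x0 y = 1 * y + - 1/4"
  "3/4 \<le> y \<Longrightarrow> y \<le> 1 \<Longrightarrow> thompson_x0 y = 2 * y + - 1"
  by (auto simp: thompson_x0_def)

lemma thompson_x1_affine:
  "0 \<le> y \<Longrightarrow> y \<le> 1/2 \<Longrightarrow> thompson_x1 y = 1 * y + 0"
  "1/2 \<le> y \<Longrightarrow> y \<le> 3/4 \<Longrightarrow> thompson_x1 y = 1/2 * y + 1/4"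
  "3/4 \<le> y \<Longrightarrow> y \<le> 7/8 \<Longrightarrow> thompson_x1 y = 1 * y + - 1/8"
  "7/8 \<le> y \<Longrightarrow> y \<le> 1 \<Longrightarrow> thompson_x1 y = 2 * y + - 1"
  by (auto simp: thompson_x1_def)

lemma sqrt_half: "sqrt (1 / 2) = sqrt 2 / 2"
  by (simp add: real_sqrt_divide field_simps)

text \<open>The image has the values \<open>sqrt 2 * p\<close>, \<open>q\<close>,
  \<open>r / sqrt 2\<close> on the intervals cut out by \<open>1/4\<close> and \<open>1/2\<close>.
  Step functions on this partition are spanned by the three listed basis vectors, and the
  coefficients solve the resulting three linear equations.\<close>

lemma koopman_x0_step:
  assumes f: "square_integrable f" and p: "\<And>y. 0 < y \<Longrightarrow> y < 1/2 \<Longrightarrow> f y = p"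
    and q: "\<And>y. 1/2 < y \<Longrightarrow> y < 3/4 \<Longrightarrow> f y = q" and r: "\<And>y. 3/4 < y \<Longrightarrow> y < 1 \<Longrightarrow> f y = r"
  shows "koopman thompson_x0 (abs_L2 f) =
      ((sqrt 2 * p + q + sqrt 2 * r) / 4) *\<^sub>R haar_const +
      ((sqrt 2 * r - sqrt 2 * p - q) / 4) *\<^sub>R haar 0 1 +
      ((q - sqrt 2 * p) / (2 * sqrt 2)) *\<^sub>R haar 1 1"
proof -
  define a b c where "a = (sqrt 2 * p + q + sqrt 2 * r) / 4"
    and "b = (sqrt 2 * r - sqrt 2 * p - q) / 4" and "c = (q - sqrt 2 * p) / (2 * sqrt 2)"
  have c: "c * sqrt 2 = (q - sqrt 2 * p) / 2" by (simp add: c_def)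
  let ?F = "\<lambda>x. a * 1 + b * haar_fun 0 1 x + c * haar_fun 1 1 x"
  let ?g = "inv\<^bsub>thompson_F\<^esub> thompson_x0"
  \<comment> \<open>Each piece contributes four facts, so \<open>aff(1-4)\<close>,
    \<open>aff(5-8)\<close> and \<open>aff(9-12)\<close> belong to the three pieces in
    order.\<close>
  note aff = thompson_inv_affine[OF thompson_x0_in_F _ _ _ thompson_x0_affine(1), of 0 "1/2"]
    thompson_inv_affine[OF thompson_x0_in_F _ _ _ thompson_x0_affine(2), of "1/2" "3/4"]
    thompson_inv_affine[OF thompson_x0_in_F _ _ _ thompson_x0_affine(3), of "3/4" 1]
  \<comment> \<open>The excluded points \<open>1/4\<close> and \<open>1/2\<close> are the images of
    the break points \<open>1/2\<close> and \<open>3/4\<close>.\<close>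
  have "sqrt (deriv ?g x) * f (?g x) = ?F x" if x: "x \<in> {0<..<1} - {1/4, 1/2}" for x
  proof -
    consider "0 < x" "x < 1/4" | "1/4 < x" "x < 1/2" | "1/2 < x" "x < 1" using x by force
    then show ?thesis
    proof cases
      case 1
      have "sqrt (deriv ?g x) * f (?g x) = sqrt 2 * p"
        using 1 aff(1-4)[of x] p[of "?g x"] by simp
      also have "\<dots> = a - b - c * sqrt 2" unfolding c by (simp add: a_def b_def field_simps)
      also have "\<dots> = ?F x" using 1 by (simp add: haar_fun_def powr_half_sqrt)
      finally show ?thesis .
    next
      case 2
      have "sqrt (deriv ?g x) * f (?g x) = q"
        using 2 aff(5-8)[of x] q[of "?g x"] by simp
      also have "\<dots> = a - b + c * sqrt 2" unfolding c by (simp add: a_def b_def field_simps)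
      also have "\<dots> = ?F x" using 2 by (simp add: haar_fun_def powr_half_sqrt)
      finally show ?thesis .
    next
      case 3
      have "sqrt (deriv ?g x) * f (?g x) = sqrt (1 / 2) * r"
        using 3 aff(9-12)[of x] r[of "?g x"] by simp
      also have "\<dots> = a + b" by (simp add: sqrt_half a_def b_def field_simps)
      also have "\<dots> = ?F x" using 3 by (simp add: haar_fun_def)
      finally show ?thesis .
    qed
  qed
  then have "koopman thompson_x0 (abs_L2 f) = abs_L2 ?F"
    by (intro koopman_abs_L2 thompson_x0_in_F f square_integrable_add square_integrable_scale
        square_integrable_one square_integrable_haar
        AE_unit_measure_if_finite[of "{1/4, 1/2}"]) auto
  also have "\<dots> = a *\<^sub>R haar_const + b *\<^sub>R haar 0 1 + c *\<^sub>R haar 1 1"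
    by (simp only: haar_def haar_const_def scaleR_abs_L2 plus_abs_L2 square_integrable_add
        square_integrable_scale square_integrable_one square_integrable_haar)
  finally show ?thesis by (simp only: a_def b_def c_def)
qed

text \<open>As for \<open>x0\<close>, now with image values \<open>z\<close>,
  \<open>sqrt 2 * p\<close>, \<open>q\<close>, \<open>r / sqrt 2\<close> on the partition by
  \<open>1/2\<close>, \<open>5/8\<close>, \<open>3/4\<close>, the images of the break points. The
  midpoints of the three Haar functions are \<open>1/2\<close>, \<open>3/4\<close> and
  \<open>5/8\<close>.\<close>

lemma koopman_x1_step:
  assumes f: "square_integrable f" and z: "\<And>y. 0 < y \<Longrightarrow> y < 1/2 \<Longrightarrow> f y = z"
    and p: "\<And>y. 1/2 < y \<Longrightarrow> y < 3/4 \<Longrightarrow> f y = p" and q: "\<And>y. 3/4 < y \<Longrightarrow> y < 7/8 \<Longrightarrow> f y = q"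
    and r: "\<And>y. 7/8 < y \<Longrightarrow> y < 1 \<Longrightarrow> f y = r"
  shows "koopman thompson_x1 (abs_L2 f) =
      ((4 * z + sqrt 2 * p + q + sqrt 2 * r) / 8) *\<^sub>R haar_const +
      ((sqrt 2 * p + q + sqrt 2 * r - 4 * z) / 8) *\<^sub>R haar 0 1 +
      ((sqrt 2 * r - sqrt 2 * p - q) / (4 * sqrt 2)) *\<^sub>R haar 1 2 +
      ((q - sqrt 2 * p) / 4) *\<^sub>R haar 2 3"
proof -
  define a b c d where "a = (4 * z + sqrt 2 * p + q + sqrt 2 * r) / 8"
    and "b = (sqrt 2 * p + q + sqrt 2 * r - 4 * z) / 8"
    and "c = (sqrt 2 * r - sqrt 2 * p - q) / (4 * sqrt 2)" and "d = (q - sqrt 2 * p) / 4"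
  have c: "c * sqrt 2 = (sqrt 2 * r - sqrt 2 * p - q) / 4" by (simp add: c_def)
  let ?F = "\<lambda>x. a * 1 + b * haar_fun 0 1 x + c * haar_fun 1 2 x + d * haar_fun 2 3 x"
  let ?g = "inv\<^bsub>thompson_F\<^esub> thompson_x1"
  note aff = thompson_inv_affine[OF thompson_x1_in_F _ _ _ thompson_x1_affine(1), of 0 "1/2"]
    thompson_inv_affine[OF thompson_x1_in_F _ _ _ thompson_x1_affine(2), of "1/2" "3/4"]
    thompson_inv_affine[OF thompson_x1_in_F _ _ _ thompson_x1_affine(3), of "3/4" "7/8"]
    thompson_inv_affine[OF thompson_x1_in_F _ _ _ thompson_x1_affine(4), of "7/8" 1]
  have "sqrt (deriv ?g x) * f (?g x) = ?F x" if x: "x \<in> {0<..<1} - {1/2, 5/8, 3/4}" for x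
  proof -
    consider "0 < x" "x < 1/2" | "1/2 < x" "x < 5/8" | "5/8 < x" "x < 3/4" | "3/4 < x" "x < 1"
      using x by force
    then show ?thesis
    proof cases
      case 1
      have "sqrt (deriv ?g x) * f (?g x) = z"
        using 1 aff(1-4)[of x] z[of "?g x"] by simp
      also have "\<dots> = a - b" by (simp add: a_def b_def field_simps)
      also have "\<dots> = ?F x" using 1 by (simp add: haar_fun_def)
      finally show ?thesis .
    next
      case 2
      have "sqrt (deriv ?g x) * f (?g x) = sqrt 2 * p"
        using 2 aff(5-8)[of x] p[of "?g x"] by simp
      also have "\<dots> = a + b - c * sqrt 2 - d * 2"
        unfolding c by (simp add: a_def b_def d_def field_simps)
      also have "\<dots> = ?F x" using 2 by (simp add: haar_fun_def powr_half_sqrt)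
      finally show ?thesis .
    next
      case 3
      have "sqrt (deriv ?g x) * f (?g x) = q"
        using 3 aff(9-12)[of x] q[of "?g x"] by simp
      also have "\<dots> = a + b - c * sqrt 2 + d * 2"
        unfolding c by (simp add: a_def b_def d_def field_simps)
      also have "\<dots> = ?F x" using 3 by (simp add: haar_fun_def powr_half_sqrt)
      finally show ?thesis .
    next
      case 4
      have "sqrt (deriv ?g x) * f (?g x) = sqrt (1 / 2) * r"
        using 4 aff(13-16)[of x] r[of "?g x"] by simp
      also have "\<dots> = a + b + c * sqrt 2"
        unfolding c by (simp add: sqrt_half a_def b_def field_simps)
      also have "\<dots> = ?F x" using 4 by (simp add: haar_fun_def powr_half_sqrt)
      finally show ?thesis .
    qed
  qed
  then have "koopman thompson_x1 (abs_L2 f) = abs_L2 ?F"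
    by (intro koopman_abs_L2 thompson_x1_in_F f square_integrable_add square_integrable_scale
        square_integrable_one square_integrable_haar
        AE_unit_measure_if_finite[of "{1/2, 5/8, 3/4}"]) auto
  also have "\<dots> = a *\<^sub>R haar_const + b *\<^sub>R haar 0 1 + c *\<^sub>R haar 1 2 + d *\<^sub>R haar 2 3"
    by (simp only: haar_def haar_const_def scaleR_abs_L2 plus_abs_L2 square_integrable_add
        square_integrable_scale square_integrable_one square_integrable_haar)
  finally show ?thesis by (simp only: a_def b_def c_def d_def)
qed

lemma sqrt2_bounds: "7/5 < sqrt 2" "sqrt 2 < 3/2"
proof -
  show "7/5 < sqrt 2" by (rule real_less_rsqrt) (simp add: power2_eq_square)
  show "sqrt 2 < 3/2" by (rule real_less_lsqrt) (simp_all add: power2_eq_square)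
qed

lemma haar_basis_small:
  "haar_const \<in> haar_basis" "haar 0 1 \<in> haar_basis" "haar 1 1 \<in> haar_basis"
  "haar 1 2 \<in> haar_basis" "haar 2 3 \<in> haar_basis" "haar 2 4 \<in> haar_basis"
proof -
  show "haar_const \<in> haar_basis" by (simp add: haar_basis_def)
qed (simp_all add: haar_in_haar_basis)

lemma inner_x0_special:
  assumes h: "h \<in> {haar_const, haar 0 1, haar 1 2}" and w: "w \<in> haar_basis"
  shows "inner (koopman thompson_x0 h) w \<noteq> 0 \<longleftrightarrow> w \<in> {haar_const, haar 0 1, haar 1 1}"
proof -
  have neq: "haar_const \<noteq> haar 0 1" "haar_const \<noteq> haar 1 1" "haar 0 1 \<noteq> haar 1 1"
    using haar_neq_const[of 1 0] haar_neq_const[of 1 1] by (simp_all add: haar_eq_iff eq_commute)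
  \<comment> \<open>All three vertices are treated alike through their values on the pieces. The
    three inequalities say that the numerators in \<open>koopman_x0_step\<close> do not
    vanish.\<close>
  have "\<exists>f p q r. h = abs_L2 f \<and> square_integrable f \<and> (\<forall>y. 0 < y \<longrightarrow> y < 1/2 \<longrightarrow> f y = p) \<and>
      (\<forall>y. 1/2 < y \<longrightarrow> y < 3/4 \<longrightarrow> f y = q) \<and> (\<forall>y. 3/4 < y \<longrightarrow> y < 1 \<longrightarrow> f y = r) \<and>
      sqrt 2 * p + q + sqrt 2 * r \<noteq> 0 \<and> sqrt 2 * r - sqrt 2 * p - q \<noteq> 0 \<and> q - sqrt 2 * p \<noteq> 0"
    using h
  proof (elim insertE emptyE)
    assume "h = haar_const"
    show ?thesis
      by (rule exI[of _ "\<lambda>_. 1"], rule exI[of _ 1], rule exI[of _ 1], rule exI[of _ 1])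
        (use \<open>h = haar_const\<close> sqrt2_bounds square_integrable_one in
          \<open>simp add: haar_const_def haar_fun_def powr_half_sqrt\<close>)
  next
    assume "h = haar 0 1"
    show ?thesis
      by (rule exI[of _ "haar_fun 0 1"], rule exI[of _ "- 1"], rule exI[of _ 1], rule exI[of _ 1])
        (use \<open>h = haar 0 1\<close> sqrt2_bounds square_integrable_haar[of 0 1] in
          \<open>simp add: haar_def haar_fun_def powr_half_sqrt\<close>)
  next
    assume "h = haar 1 2"
    \<comment> \<open>This function vanishes left of \<open>1/2\<close>, jumps at the break point
      \<open>3/4\<close> and has height \<open>sqrt 2\<close>.\<close>
    show ?thesis
      by (rule exI[of _ "haar_fun 1 2"], rule exI[of _ 0], rule exI[of _ "- sqrt 2"], rule exI[of _ "sqrt 2"])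
        (use \<open>h = haar 1 2\<close> sqrt2_bounds square_integrable_haar[of 1 2] in
          \<open>simp add: haar_def haar_fun_def powr_half_sqrt\<close>)
  qed
  then obtain f p q r where f: "h = abs_L2 f" "square_integrable f"
      "\<And>y. 0 < y \<Longrightarrow> y < 1/2 \<Longrightarrow> f y = p" "\<And>y. 1/2 < y \<Longrightarrow> y < 3/4 \<Longrightarrow> f y = q"
      "\<And>y. 3/4 < y \<Longrightarrow> y < 1 \<Longrightarrow> f y = r"
    and nz: "sqrt 2 * p + q + sqrt 2 * r \<noteq> 0" "sqrt 2 * r - sqrt 2 * p - q \<noteq> 0" "q - sqrt 2 * p \<noteq> 0"
    by blast
  show ?thesis
    using w neq nz
    by (auto simp: f(1) koopman_x0_step[OF f(2-5)] inner_add_left inner_haar_basis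
        haar_basis_small[unfolded One_nat_def])
qed

lemma inner_x1_special:
  assumes h: "h \<in> {haar_const, haar 0 1, haar 1 2, haar 2 4}" and w: "w \<in> haar_basis"
  shows "inner (koopman thompson_x1 h) w \<noteq> 0 \<longleftrightarrow> w \<in> {haar_const, haar 0 1, haar 1 2, haar 2 3}"
proof -
  have neq: "haar_const \<noteq> haar 0 1" "haar_const \<noteq> haar 1 2" "haar_const \<noteq> haar 2 3"
    "haar 0 1 \<noteq> haar 1 2" "haar 0 1 \<noteq> haar 2 3" "haar 1 2 \<noteq> haar 2 3"
    using haar_neq_const[of 1 0] haar_neq_const[of 2 1] haar_neq_const[of 3 2]
    by (simp_all add: haar_eq_iff eq_commute)
  have "\<exists>f z p q r. h = abs_L2 f \<and> square_integrable f \<and> (\<forall>y. 0 < y \<longrightarrow> y < 1/2 \<longrightarrow> f y = z) \<and>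
      (\<forall>y. 1/2 < y \<longrightarrow> y < 3/4 \<longrightarrow> f y = p) \<and> (\<forall>y. 3/4 < y \<longrightarrow> y < 7/8 \<longrightarrow> f y = q) \<and>
      (\<forall>y. 7/8 < y \<longrightarrow> y < 1 \<longrightarrow> f y = r) \<and>
      4 * z + sqrt 2 * p + q + sqrt 2 * r \<noteq> 0 \<and> sqrt 2 * p + q + sqrt 2 * r - 4 * z \<noteq> 0 \<and>
      sqrt 2 * r - sqrt 2 * p - q \<noteq> 0 \<and> q - sqrt 2 * p \<noteq> 0"
    using h
  proof (elim insertE emptyE)
    assume "h = haar_const"
    \<comment> \<open>The coefficient of \<open>haar 0 1\<close> has numerator
      \<open>2 * sqrt 2 - 3\<close>, which is negative because \<open>sqrt 2 < 3/2\<close>.\<close>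
    show ?thesis
      by (rule exI[of _ "\<lambda>_. 1"], rule exI[of _ 1], rule exI[of _ 1], rule exI[of _ 1], rule exI[of _ 1])
        (use \<open>h = haar_const\<close> sqrt2_bounds square_integrable_one in
          \<open>simp add: haar_const_def haar_fun_def powr_half_sqrt\<close>)
  next
    assume "h = haar 0 1"
    show ?thesis
      by (rule exI[of _ "haar_fun 0 1"], rule exI[of _ "- 1"], rule exI[of _ 1], rule exI[of _ 1], rule exI[of _ 1])
        (use \<open>h = haar 0 1\<close> sqrt2_bounds square_integrable_haar[of 0 1] in
          \<open>simp add: haar_def haar_fun_def powr_half_sqrt\<close>)
  next
    assume "h = haar 1 2"
    show ?thesis
      by (rule exI[of _ "haar_fun 1 2"], rule exI[of _ 0], rule exI[of _ "- sqrt 2"], rule exI[of _ "sqrt 2"], rule exI[of _ "sqrt 2"])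
        (use \<open>h = haar 1 2\<close> sqrt2_bounds square_integrable_haar[of 1 2] in
          \<open>simp add: haar_def haar_fun_def powr_half_sqrt\<close>)
  next
    assume "h = haar 2 4"
    \<comment> \<open>The support starts at \<open>3/4\<close>, the jump is at the break point
      \<open>7/8\<close>, and the height is \<open>2\<close>.\<close>
    show ?thesis
      by (rule exI[of _ "haar_fun 2 4"], rule exI[of _ 0], rule exI[of _ 0], rule exI[of _ "- 2"], rule exI[of _ 2])
        (use \<open>h = haar 2 4\<close> sqrt2_bounds square_integrable_haar[of 2 4] in
          \<open>simp add: haar_def haar_fun_def powr_half_sqrt\<close>)
  qed
  then obtain f z p q r where f: "h = abs_L2 f" "square_integrable f"
      "\<And>y. 0 < y \<Longrightarrow> y < 1/2 \<Longrightarrow> f y = z" "\<And>y. 1/2 < y \<Longrightarrow> y < 3/4 \<Longrightarrow> f y = p"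
      "\<And>y. 3/4 < y \<Longrightarrow> y < 7/8 \<Longrightarrow> f y = q" "\<And>y. 7/8 < y \<Longrightarrow> y < 1 \<Longrightarrow> f y = r"
    and nz: "4 * z + sqrt 2 * p + q + sqrt 2 * r \<noteq> 0" "sqrt 2 * p + q + sqrt 2 * r - 4 * z \<noteq> 0"
      "sqrt 2 * r - sqrt 2 * p - q \<noteq> 0" "q - sqrt 2 * p \<noteq> 0"
    by blast
  show ?thesis
    using w neq nz
    by (auto simp: f(1) koopman_x1_step[OF f(2-6)] inner_add_left inner_haar_basis
        haar_basis_small[unfolded One_nat_def])
qed

section \<open>Vertices with a single arrow\<close>

text \<open>The affine formula is required on a whole piece \<open>{a..b}\<close> containing the
  support. The target indices are absent from the conclusion, so all pieces yield the same
  statement.\<close>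

lemma koopman_haar_piece:
  assumes g: "g \<in> carrier thompson_F" and ij: "1 \<le> j" "j \<le> 2 ^ i" and kl: "1 \<le> l" "l \<le> 2 ^ k"
    and sub: "a \<le> (real j - 1) / 2 ^ i" "real j / 2 ^ i \<le> b"
    and aff: "\<And>y. a \<le> y \<Longrightarrow> y \<le> b \<Longrightarrow> g y = (2 ^ i * y + real l - real j) / 2 ^ k"
  shows "koopman g (haar i j) = haar_psi_inv (g (haar_psi (haar i j))) \<and>
    haar_psi_inv (g (haar_psi (haar i j))) \<in> haar_basis"
proof -
  have "g y = (2 ^ i * y + real l - real j) / 2 ^ k"
    if "(real j - 1) / 2 ^ i \<le> y" "y \<le> real j / 2 ^ i" for y
    using that sub by (intro aff) linarith+
  note * = koopman_haar_affine[OF g ij kl this]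
  show ?thesis using haar_in_haar_basis[OF kl] by (simp only: * simp_thms)
qed

text \<open>A dyadic interval does not straddle a point of its own grid. Once the exceptional
  functions are removed, comparing \<open>j\<close> with the indices of \<open>1/2\<close> and
  \<open>3/4\<close> finds the piece that contains the support.\<close>

lemma koopman_x0_regular:
  assumes h: "h \<in> haar_basis - {haar_const, haar 0 1, haar 1 2}"
  shows "koopman thompson_x0 h = haar_psi_inv (thompson_x0 (haar_psi h)) \<and>
    haar_psi_inv (thompson_x0 (haar_psi h)) \<in> haar_basis"
proof -
  obtain i j where ij: "h = haar i j" "1 \<le> j" "j \<le> 2 ^ i" "(i, j) \<noteq> (0, 1)" "(i, j) \<noteq> (1, 2)"
    using h unfolding haar_basis_def by blast
  note piece = koopman_haar_piece[OF thompson_x0_in_F ij(2,3)]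
  have J: "0 \<le> (real j - 1) / 2 ^ i" "real j / 2 ^ i \<le> 1"
    using haar_interval[OF ij(2,3)] by auto
  \<comment> \<open>Level \<open>0\<close> consists of the excluded \<open>haar 0 1\<close> alone,
    so \<open>1/2\<close> is a grid point.\<close>
  obtain n where i: "i = Suc n" using ij by (cases i) auto
  have "koopman thompson_x0 (haar i j) = haar_psi_inv (thompson_x0 (haar_psi (haar i j))) \<and>
    haar_psi_inv (thompson_x0 (haar_psi (haar i j))) \<in> haar_basis"
  proof (cases "j \<le> 2 ^ n")
    case True
    then have "real j \<le> 2 ^ n" by (metis of_nat_le_iff of_nat_numeral of_nat_power)
    then have hi: "real j / 2 ^ i \<le> 1/2" by (simp add: i field_simps)
    \<comment> \<open>Halving keeps the index and raises the level by one.\<close>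
    show ?thesis
      by (rule piece[of j "Suc i", OF _ _ J(1) hi])
        (use ij(2,3) in \<open>simp_all add: thompson_x0_affine(1)\<close>)
  next
    case False
    \<comment> \<open>At level \<open>1\<close> the only function right of \<open>1/2\<close> is the
      excluded \<open>haar 1 2\<close>, so the level is at least \<open>2\<close> and
      \<open>3/4\<close> is a grid point.\<close>
    then obtain m where n: "n = Suc m" using ij(3-5) by (cases n) (auto simp: i)
    from False have jlo: "2 * 2 ^ m + 1 \<le> j" by (simp add: n)
    then have "real (2 * 2 ^ m + 1) \<le> real j" by (simp only: of_nat_le_iff)
    then have lo: "1/2 \<le> (real j - 1) / 2 ^ i" by (simp add: i n field_simps)
    show ?thesis
    proof (cases "j \<le> 3 * 2 ^ m")
      case True
      then have "real j \<le> real (3 * 2 ^ m)" by (simp only: of_nat_le_iff)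
      then have hi: "real j / 2 ^ i \<le> 3/4" by (simp add: i n field_simps)
      \<comment> \<open>Translation by \<open>-1/4\<close> is a shift by \<open>2 ^ m\<close> cells
        at level \<open>i = m + 2\<close>.\<close>
      show ?thesis
        by (rule piece[of "j - 2 ^ m" i, OF _ _ lo hi])
          (use ij(3) jlo in \<open>simp_all add: thompson_x0_affine(2) of_nat_diff i n field_simps\<close>)
    next
      case False
      then have "real (3 * 2 ^ m + 1) \<le> real j" by (subst of_nat_le_iff) simp
      then have lo: "3/4 \<le> (real j - 1) / 2 ^ i" by (simp add: i n field_simps)
      \<comment> \<open>Doubling lowers the level to \<open>n\<close>, and subtracting
        \<open>1\<close> removes \<open>2 ^ n = 2 * 2 ^ m\<close> cells there.\<close>
      show ?thesis
        by (rule piece[of "j - 2 * 2 ^ m" n, OF _ _ lo J(2)])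
          (use ij(3) jlo in \<open>simp_all add: thompson_x0_affine(3) of_nat_diff i n field_simps\<close>)
    qed
  qed
  then show ?thesis by (simp only: ij(1))
qed

lemma koopman_x1_regular:
  assumes h: "h \<in> haar_basis - {haar_const, haar 0 1, haar 1 2, haar 2 4}"
  shows "koopman thompson_x1 h = haar_psi_inv (thompson_x1 (haar_psi h)) \<and>
    haar_psi_inv (thompson_x1 (haar_psi h)) \<in> haar_basis"
proof -
  obtain i j where ij: "h = haar i j" "1 \<le> j" "j \<le> 2 ^ i" "(i, j) \<noteq> (0, 1)" "(i, j) \<noteq> (1, 2)"
      "(i, j) \<noteq> (2, 4)"
    using h unfolding haar_basis_def by blast
  note piece = koopman_haar_piece[OF thompson_x1_in_F ij(2,3)]
  have J: "0 \<le> (real j - 1) / 2 ^ i" "real j / 2 ^ i \<le> 1"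
    using haar_interval[OF ij(2,3)] by auto
  obtain n where i: "i = Suc n" using ij by (cases i) auto
  have "koopman thompson_x1 (haar i j) = haar_psi_inv (thompson_x1 (haar_psi (haar i j))) \<and>
    haar_psi_inv (thompson_x1 (haar_psi (haar i j))) \<in> haar_basis"
  proof (cases "j \<le> 2 ^ n")
    case True
    then have "real j \<le> 2 ^ n" by (metis of_nat_le_iff of_nat_numeral of_nat_power)
    then have hi: "real j / 2 ^ i \<le> 1/2" by (simp add: i field_simps)
    show ?thesis
      by (rule piece[of j i, OF _ _ J(1) hi])
        (use ij(2,3) in \<open>simp_all add: thompson_x1_affine(1)\<close>)
  next
    case False
    then obtain m where n: "n = Suc m" using ij(3-5) by (cases n) (auto simp: i)
    from False have "2 * 2 ^ m + 1 \<le> j" by (simp add: n)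
    then have "real (2 * 2 ^ m + 1) \<le> real j" by (simp only: of_nat_le_iff)
    then have lo: "1/2 \<le> (real j - 1) / 2 ^ i" by (simp add: i n field_simps)
    show ?thesis
    proof (cases "j \<le> 3 * 2 ^ m")
      case True
      then have "real j \<le> real (3 * 2 ^ m)" by (simp only: of_nat_le_iff)
      then have hi: "real j / 2 ^ i \<le> 3/4" by (simp add: i n field_simps)
      \<comment> \<open>At the finer level \<open>Suc i\<close>, the summand \<open>1/4\<close>
        amounts to \<open>2 * 2 ^ m\<close> cells.\<close>
      show ?thesis
        by (rule piece[of "j + 2 * 2 ^ m" "Suc i", OF _ _ lo hi])
          (use ij(2,3) in \<open>simp_all add: thompson_x1_affine(2) i n field_simps\<close>)
    next
      case False
      \<comment> \<open>At level \<open>2\<close> the only function right of \<open>3/4\<close> is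
        the excluded \<open>haar 2 4\<close>, so the level is at least \<open>3\<close> and
        \<open>7/8\<close> is a grid point.\<close>
      then obtain e where m: "m = Suc e" using ij(3,6) by (cases m) (auto simp: i n)
      from False have jlo: "6 * 2 ^ e + 1 \<le> j" by (simp add: m)
      then have "real (6 * 2 ^ e + 1) \<le> real j" by (simp only: of_nat_le_iff)
      then have lo: "3/4 \<le> (real j - 1) / 2 ^ i" by (simp add: i n m field_simps)
      show ?thesis
      proof (cases "j \<le> 7 * 2 ^ e")
        case True
        then have "real j \<le> real (7 * 2 ^ e)" by (simp only: of_nat_le_iff)
        then have hi: "real j / 2 ^ i \<le> 7/8" by (simp add: i n m field_simps)
        show ?thesis
          by (rule piece[of "j - 2 ^ e" i, OF _ _ lo hi])
            (use ij(3) jlo in \<open>simp_all add: thompson_x1_affine(3) of_nat_diff i n m field_simps\<close>)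
      next
        case False
        then have "real (7 * 2 ^ e + 1) \<le> real j" by (subst of_nat_le_iff) simp
        then have lo: "7/8 \<le> (real j - 1) / 2 ^ i" by (simp add: i n m field_simps)
        show ?thesis
          by (rule piece[of "j - 4 * 2 ^ e" n, OF _ _ lo J(2)])
            (use ij(3) jlo in \<open>simp_all add: thompson_x1_affine(4) of_nat_diff i n m field_simps\<close>)
      qed
    qed
  qed
  then show ?thesis by (simp only: ij(1))
qed

section \<open>Assembling the arrows of one label\<close>

text \<open>Outside \<open>S\<close> the image of a vertex is itself a basis vector, so
  orthonormality leaves exactly one arrow. Vertices in \<open>S\<close> are joined to all of
  \<open>T\<close>, which gives the product set.\<close>

lemma koopman_arrows:
  assumes "S \<subseteq> haar_basis" "T \<subseteq> haar_basis"
    and special: "\<And>h w. h \<in> S \<Longrightarrow> w \<in> haar_basis \<Longrightarrow> inner (koopman g h) w \<noteq> 0 \<longleftrightarrow> w \<in> T"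
    and regular: "\<And>h. h \<in> haar_basis - S \<Longrightarrow>
      koopman g h = haar_psi_inv (g (haar_psi h)) \<and> haar_psi_inv (g (haar_psi h)) \<in> haar_basis"
  shows "{(v, s, w). v \<in> haar_basis \<and> s = g \<and> w \<in> haar_basis \<and> inner (koopman s v) w \<noteq> 0} =
    S \<times> {g} \<times> T \<union> {(h, g, haar_psi_inv (g (haar_psi h))) | h. h \<in> haar_basis - S}"
proof -
  have "inner (koopman g v) w \<noteq> 0 \<longleftrightarrow> w = haar_psi_inv (g (haar_psi v))"
    if "v \<in> haar_basis - S" "w \<in> haar_basis" for v w
    using regular[OF that(1)] that(2) by (simp add: inner_haar_basis)
  then have "v \<in> haar_basis \<and> w \<in> haar_basis \<and> inner (koopman g v) w \<noteq> 0 \<longleftrightarrow>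
      v \<in> S \<and> w \<in> T \<or> v \<in> haar_basis - S \<and> w = haar_psi_inv (g (haar_psi v))" for v w
    using assms(1,2) special[of v w] regular[of v] by blast
  then show ?thesis by blast
qed

theorem proposition4:
  shows "arcs (schreier_graph koopman haar_basis {thompson_x0, thompson_x1}) =
     {haar_const, haar 0 1, haar 1 2} \<times> {thompson_x0} \<times> {haar_const, haar 0 1, haar 1 1}
   \<union> {(h, thompson_x0, haar_psi_inv (thompson_x0 (haar_psi h))) | h.
        h \<in> haar_basis - {haar_const, haar 0 1, haar 1 2}}
   \<union> {haar_const, haar 0 1, haar 1 2, haar 2 4} \<times> {thompson_x1} \<times>
        {haar_const, haar 0 1, haar 1 2, haar 2 3}
   \<union> {(h, thompson_x1, haar_psi_inv (thompson_x1 (haar_psi h))) | h.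
        h \<in> haar_basis - {haar_const, haar 0 1, haar 1 2, haar 2 4}}"
proof -
  \<comment> \<open>The two labels are separated, so that \<open>koopman_arrows\<close> applies to
    each generator.\<close>
  have "arcs (schreier_graph koopman haar_basis {thompson_x0, thompson_x1}) =
      {(v, s, w). v \<in> haar_basis \<and> s = thompson_x0 \<and> w \<in> haar_basis \<and> inner (koopman s v) w \<noteq> 0} \<union>
      {(v, s, w). v \<in> haar_basis \<and> s = thompson_x1 \<and> w \<in> haar_basis \<and> inner (koopman s v) w \<noteq> 0}"
    unfolding schreier_graph_def by auto
  moreover have "{haar_const, haar 0 1, haar 1 2, haar 2 4} \<subseteq> haar_basis"
    "{haar_const, haar 0 1, haar 1 2} \<subseteq> haar_basis" "{haar_const, haar 0 1, haar 1 1} \<subseteq> haar_basis"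
    "{haar_const, haar 0 1, haar 1 2, haar 2 3} \<subseteq> haar_basis"
    using haar_basis_small by blast+
  note koopman_arrows[OF this(2,3) inner_x0_special koopman_x0_regular]
    koopman_arrows[OF this(1,4) inner_x1_special koopman_x1_regular]
  ultimately show ?thesis by (simp only: Un_assoc)
qed

end
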